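(* Let $U$ be a non-principal ultrafilter on $\omega$. The following are equivalent: (i) $U\cdot U>_T U$ (that is, $U\le_T U\cdot U$ but $U\cdot U\not\le_T U$) and $U$ is a $p$-point; (ii) $(U,\supseteq)\not\geq_T(\omega^\omega,\leq)$; (iii) $U$ is Canjar; (iv) $U$ is a strong $p$-point; (v) $U^{<\omega}$ is a $P^+$-filter.
   Context: Tukey order: for directed posets $P,Q$, $P\le_T Q$ iff there is $f:Q\to P$ such that $f''B$ is cofinal in $P$ whenever $B$ is cofinal in $Q$; $P\equiv_T Q$ iff both $P\le_T Q$ and $Q\le_T P$. An ultrafilter $U$ is considered as the directed poset $(U,\supseteq)$. $(\omega^\omega,\le)$ is the set of functions $\omega\to\omega$ ordered by everywhere domination. The Fubini product $U\cdot U$ is the ultrafilter on $\omega\times\omega$ given by $A\in U\cdot U$ iff $\{n:\{m:(n,m)\in A\}\in U\}\in U$. $U$ is a $p$-point if for every sequence $\langle X_n\mid n<\omega\rangle\subseteq U$ there is $X\in U$ with $X\setminus X_n$ finite for every $n$. Mathias forcing restricted to $U$, $\mathbb{M}_U$, consists of pairs $\langle a,A\rangle$ with $a\in[\omega]^{<\omega}$, $A\in U$, $\min(A)>\max(a)$, ordered by $\langle a,A\rangle\le\langle b,B\rangle$ iff $b$ is an initial segment of $a$, $a\setminus b\subseteq B$ and $A\subseteq B$. A forcing $\mathbb{P}$ adds a dominating real if it forces the existence of $f\in\omega^\omega$ such that for every ground-model $g\in\omega^\omega$, $g(n)<f(n)$ for all but finitely many $n$. $U$ is Canjar if $\mathbb{M}_U$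 does not add a dominating real. $U$ is a strong $p$-point if for every sequence $\langle \mathcal{C}_n:n\in\omega\rangle$ of compact subsets of $U$ (compact in the topology of $\mathcal{P}(\omega)\cong 2^\omega$) there is a partition of $\omega$ into consecutive finite intervals $\langle I_n:n\in\omega\rangle$ such that for every $X\subseteq\omega$, if $X\cap I_n\cap C\ne\emptyset$ for all $n$ and all $C\in\mathcal{C}_n$, then $X\in U$. $\mathrm{FIN}=[\omega]^{<\omega}\setminus\{\emptyset\}$; $U^{<\omega}$ is the filter on $\mathrm{FIN}$ generated by the sets $[A]^{<\omega}\cap\mathrm{FIN}$, $A\in U$. For a filter $F$ on a set, $F^+$ is the collection of sets meeting every member of $F$; $F$ is a $P^+$-filter if for every $\subseteq$-decreasing sequence $\langle X_n\mid n<\omega\rangle\subseteq F^+$ there is $X_\infty\in F^+$ with $X_\infty\setminus X_n$ finite for all $n$.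
   Formalization: The stated definition of strong p-point is degenerate (no ultrafilter satisfies it if empty C_n are allowed; all do, via I_n={n}, if not); Laflamme's standard one is used: for compact C_n⊆U some interval partition has ⋃(X_n∩I_n)∈U for every choice X_n∈C_n. *)

theory Defs
  imports "HOL-Analysis.Analysis"
begin

definition cofinal_in :: "'a set \<Rightarrow> ('a \<Rightarrow> 'a \<Rightarrow> bool) \<Rightarrow> 'a set \<Rightarrow> bool" where
  "cofinal_in P le B \<longleftrightarrow> B \<subseteq> P \<and> (\<forall>x\<in>P. \<exists>y\<in>B. le x y)"

definition tukey_le ::
  "'a set \<Rightarrow> ('a \<Rightarrow> 'a \<Rightarrow> bool) \<Rightarrow> 'b set \<Rightarrow> ('b \<Rightarrow> 'b \<Rightarrow> bool) \<Rightarrow> bool" where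
  "tukey_le P leP Q leQ \<longleftrightarrow>
     (\<exists>f \<in> Q \<rightarrow> P. \<forall>B. cofinal_in Q leQ B \<longrightarrow> cofinal_in P leP (f ` B))"

definition tukey_less ::
  "'a set \<Rightarrow> ('a \<Rightarrow> 'a \<Rightarrow> bool) \<Rightarrow> 'b set \<Rightarrow> ('b \<Rightarrow> 'b \<Rightarrow> bool) \<Rightarrow> bool" where
  "tukey_less P leP Q leQ \<longleftrightarrow> tukey_le P leP Q leQ \<and> \<not> tukey_le Q leQ P leP"

definition ultrafilter :: "'a set set \<Rightarrow> bool" where
  "ultrafilter U \<longleftrightarrow>
     UNIV \<in> U \<and> {} \<notin> U \<and>
     (\<forall>A B. A \<in> U \<longrightarrow> A \<subseteq> B \<longrightarrow> B \<in> U) \<and>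
     (\<forall>A B. A \<in> U \<longrightarrow> B \<in> U \<longrightarrow> A \<inter> B \<in> U) \<and>
     (\<forall>A. A \<in> U \<or> - A \<in> U)"

definition nonprincipal :: "'a set set \<Rightarrow> bool" where
  "nonprincipal U \<longleftrightarrow> (\<nexists>a. U = {A. a \<in> A})"

definition fubini :: "'a set set \<Rightarrow> 'b set set \<Rightarrow> ('a \<times> 'b) set set" where
  "fubini U V = {A. {n. {m. (n, m) \<in> A} \<in> V} \<in> U}"

definition p_point :: "nat set set \<Rightarrow> bool" where
  "p_point U \<longleftrightarrow>
     (\<forall>X :: nat \<Rightarrow> nat set. range X \<subseteq> U \<longrightarrow> (\<exists>Y\<in>U. \<forall>n. finite (Y - X n)))"

text \<open>
  Forcing over a preorder \<open>le\<close> with carrier \<open>P\<close>; smaller conditions are stronger and the ambient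
  universe is the ground model. A formula of the forcing language is represented by the predicate
  \<open>\<lambda>p. p \<tturnstile> \<phi>\<close> on conditions, and the combinators below are the usual recursive clauses of the
  forcing relation. A subset of a ground-model set of type \<open>'a\<close> has a name that is a set of pairs of
  (the canonical name of) an element of \<open>'a\<close> and a condition.
\<close>

type_synonym ('a, 'p) subset_name = "('a \<times> 'p) set"

definition dense_below :: "'p set \<Rightarrow> ('p \<Rightarrow> 'p \<Rightarrow> bool) \<Rightarrow> ('p \<Rightarrow> bool) \<Rightarrow> 'p \<Rightarrow> bool" where
  "dense_below P le D p \<longleftrightarrow> (\<forall>q\<in>P. le q p \<longrightarrow> (\<exists>r\<in>P. le r q \<and> D r))"

definition forces_mem ::
  "'p set \<Rightarrow> ('p \<Rightarrow> 'p \<Rightarrow> bool) \<Rightarrow> 'a \<Rightarrow> ('a, 'p) subset_name \<Rightarrow> 'p \<Rightarrow> bool" where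
  "forces_mem P le x \<tau> = dense_below P le (\<lambda>q. \<exists>s\<in>P. (x, s) \<in> \<tau> \<and> le q s)"

definition forces_conj :: "('p \<Rightarrow> bool) \<Rightarrow> ('p \<Rightarrow> bool) \<Rightarrow> 'p \<Rightarrow> bool" where
  "forces_conj \<phi> \<psi> p \<longleftrightarrow> \<phi> p \<and> \<psi> p"

definition forces_imp ::
  "'p set \<Rightarrow> ('p \<Rightarrow> 'p \<Rightarrow> bool) \<Rightarrow> ('p \<Rightarrow> bool) \<Rightarrow> ('p \<Rightarrow> bool) \<Rightarrow> 'p \<Rightarrow> bool" where
  "forces_imp P le \<phi> \<psi> p \<longleftrightarrow> (\<forall>q\<in>P. le q p \<longrightarrow> \<phi> q \<longrightarrow> \<psi> q)"

definition forces_all :: "('x \<Rightarrow> 'p \<Rightarrow> bool) \<Rightarrow> 'p \<Rightarrow> bool" where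
  "forces_all \<phi> p \<longleftrightarrow> (\<forall>x. \<phi> x p)"

definition forces_ex ::
  "'p set \<Rightarrow> ('p \<Rightarrow> 'p \<Rightarrow> bool) \<Rightarrow> ('x \<Rightarrow> 'p \<Rightarrow> bool) \<Rightarrow> 'p \<Rightarrow> bool" where
  "forces_ex P le \<phi> = dense_below P le (\<lambda>q. \<exists>x. \<phi> x q)"

text \<open>A statement \<open>b\<close> about ground-model natural numbers is absolute.\<close>

definition forces_check :: "bool \<Rightarrow> 'p \<Rightarrow> bool" where
  "forces_check b p \<longleftrightarrow> b"

definition forces_function ::
  "'p set \<Rightarrow> ('p \<Rightarrow> 'p \<Rightarrow> bool) \<Rightarrow> (nat \<times> nat, 'p) subset_name \<Rightarrow> 'p \<Rightarrow> bool" where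
  "forces_function P le \<tau> =
     forces_conj
       (forces_all (\<lambda>n. forces_ex P le (\<lambda>m. forces_mem P le (n, m) \<tau>)))
       (forces_all (\<lambda>n. forces_all (\<lambda>m. forces_all (\<lambda>m'.
          forces_imp P le
            (forces_conj (forces_mem P le (n, m) \<tau>) (forces_mem P le (n, m') \<tau>))
            (forces_check (m = m'))))))"

text \<open>\<open>\<exists>k. \<forall>n. k \<le> n \<longrightarrow> g n < \<tau> n\<close>, for \<open>g\<close> in the ground model\<close>

definition forces_dominates ::
  "'p set \<Rightarrow> ('p \<Rightarrow> 'p \<Rightarrow> bool) \<Rightarrow> (nat \<Rightarrow> nat) \<Rightarrow> (nat \<times> nat, 'p) subset_name \<Rightarrow> 'p \<Rightarrow> bool" where
  "forces_dominates P le g \<tau> =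
     forces_ex P le (\<lambda>k. forces_all (\<lambda>n.
       forces_imp P le (forces_check (k \<le> n))
         (forces_all (\<lambda>m.
           forces_imp P le (forces_mem P le (n, m) \<tau>) (forces_check (g n < m))))))"

definition adds_dominating_real :: "'p set \<Rightarrow> ('p \<Rightarrow> 'p \<Rightarrow> bool) \<Rightarrow> bool" where
  "adds_dominating_real P le \<longleftrightarrow>
     (\<forall>p\<in>P.
        forces_ex P le
          (\<lambda>\<tau>. forces_conj (forces_function P le \<tau>)
                 (forces_all (\<lambda>g. forces_dominates P le g \<tau>))) p)"

definition mathias :: "nat set set \<Rightarrow> (nat set \<times> nat set) set" where
  "mathias U = {(a, A). finite a \<and> A \<in> U \<and> (\<forall>x\<in>a. \<forall>y\<in>A. x < y)}"

definition initial_segment :: "nat set \<Rightarrow> nat set \<Rightarrow> bool" where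
  "initial_segment b a \<longleftrightarrow> b \<subseteq> a \<and> (\<forall>y\<in>b. \<forall>x\<in>a. x \<le> y \<longrightarrow> x \<in> b)"

fun mathias_le :: "nat set \<times> nat set \<Rightarrow> nat set \<times> nat set \<Rightarrow> bool" where
  "mathias_le (a, A) (b, B) \<longleftrightarrow> initial_segment b a \<and> a - b \<subseteq> B \<and> A \<subseteq> B"

definition canjar :: "nat set set \<Rightarrow> bool" where
  "canjar U \<longleftrightarrow> \<not> adds_dominating_real (mathias U) mathias_le"

text \<open>
  A family of subsets of \<open>\<nat>\<close> is compact if its set of characteristic functions is
  compact in the product space \<open>nat \<Rightarrow> bool\<close>. The interval partitions are the sequences
  \<open>{k n..<k (Suc n)}\<close> with \<open>k\<close> strictly increasing and \<open>k 0 = 0\<close>. The sets required to lie in \<open>U\<close> are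
  those that agree on each \<open>I\<^sub>n\<close> with some member of \<open>\<C>\<^sub>n\<close>. (Requiring instead that every \<open>X\<close> meeting
  \<open>I\<^sub>n \<inter> C\<close> for all \<open>n\<close> and all \<open>C \<in> \<C>\<^sub>n\<close> be in \<open>U\<close> is degenerate: it fails for \<open>\<C>\<^sub>n = {}\<close>, and for
  nonempty \<open>\<C>\<^sub>n\<close> the singletons \<open>I\<^sub>n = {n}\<close> always witness it.)
\<close>

definition compact_family :: "nat set set \<Rightarrow> bool" where
  "compact_family \<C> \<longleftrightarrow> compact ((\<lambda>A n. n \<in> A) ` \<C>)"

definition strong_p_point :: "nat set set \<Rightarrow> bool" where
  "strong_p_point U \<longleftrightarrow>
     (\<forall>\<C> :: nat \<Rightarrow> nat set set.
        (\<forall>n. \<C> n \<subseteq> U \<and> compact_family (\<C> n)) \<longrightarrow>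
        (\<exists>k :: nat \<Rightarrow> nat. strict_mono k \<and> k 0 = 0 \<and>
           (\<forall>X. (\<forall>n. X n \<in> \<C> n) \<longrightarrow> (\<Union>n. X n \<inter> {k n..<k (Suc n)}) \<in> U)))"

text \<open>Below, a filter on \<open>S\<close> is a family of subsets of the carrier \<open>S\<close>.\<close>

definition FIN :: "nat set set" where
  "FIN = {a. finite a \<and> a \<noteq> {}}"

definition generated_filter :: "'a set \<Rightarrow> 'a set set \<Rightarrow> 'a set set" where
  "generated_filter S \<B> = {X. X \<subseteq> S \<and> (\<exists>\<F>. finite \<F> \<and> \<F> \<subseteq> \<B> \<and> S \<inter> \<Inter>\<F> \<subseteq> X)}"

definition fin_filter :: "nat set set \<Rightarrow> nat set set set" where
  "fin_filter U = generated_filter FIN ((\<lambda>A. {a \<in> FIN. a \<subseteq> A}) ` U)"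

definition positive_sets :: "'a set \<Rightarrow> 'a set set \<Rightarrow> 'a set set" where
  "positive_sets S F = {X. X \<subseteq> S \<and> (\<forall>A\<in>F. X \<inter> A \<noteq> {})}"

definition P_plus_filter :: "'a set \<Rightarrow> 'a set set \<Rightarrow> bool" where
  "P_plus_filter S F \<longleftrightarrow>
     (\<forall>X :: nat \<Rightarrow> 'a set.
        range X \<subseteq> positive_sets S F \<longrightarrow> decseq X \<longrightarrow>
        (\<exists>Y \<in> positive_sets S F. \<forall>n. finite (Y - X n)))"

end

theory Submission
  imports Defs
begin

text \<open>
  Dually to cofinal maps, \<open>P \<le>\<^sub>T Q\<close> means that some \<open>\<psi> : P \<rightarrow> Q\<close> has only bounded preimages of
  bounded sets. The negations of (ii), (iv) and (iii) imply one another in a cycle. A Tukey map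
  \<open>\<omega>\<^sup>\<omega> \<rightarrow> U\<close> becomes continuous below some member of a p-point and then yields compact sets violating
  (iv). Compact sets \<open>\<C>\<^sub>n\<close> violating (iv) make the time the Mathias real needs to meet all members of
  \<open>\<C>\<^sub>0, \<dots>, \<C>\<^sub>n\<close> grow faster than every ground model function. A name for a dominating real sends
  \<open>g\<close> to the second coordinate of a condition forcing domination of \<open>g\<close>, which is a Tukey map.
  For (iv) and (v), a positive set \<open>X\<close> of finite sets corresponds to the compact subset of \<open>U\<close>
  consisting of the sets meeting all elements of \<open>X\<close>. Finally \<open>\<omega>\<^sup>\<omega> \<le>\<^sub>T U \<cdot> U\<close> always holds, and if \<open>U\<close> is a p-point with
  \<open>\<omega>\<^sup>\<omega> \<le>\<^sub>T U\<close>, then a member of \<open>U \<cdot> U\<close> is coded by a pseudo-intersection of its sections together with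
  the function measuring the finite errors, so \<open>U \<cdot> U \<le>\<^sub>T U\<close>.
\<close>

section \<open>Tukey maps\<close>

text \<open>For a cofinal map \<open>f\<close>, the \<open>q\<close> with \<open>p\<close> not below
  \<open>f q\<close> are not cofinal, so some \<open>\<psi> p\<close> has none of them above it.
  Conversely, any choice of bounds for the preimages is a cofinal map.\<close>

lemma tukey_le_iff_unbounded_map:
  "tukey_le P leP Q leQ \<longleftrightarrow>
     (\<exists>\<psi>\<in>P \<rightarrow> Q. \<forall>q\<in>Q. \<exists>b\<in>P. \<forall>p\<in>P. leQ (\<psi> p) q \<longrightarrow> leP p b)"
proof
  assume "tukey_le P leP Q leQ"
  then obtain f where f: "f \<in> Q \<rightarrow> P"
    and cof: "\<And>B. cofinal_in Q leQ B \<Longrightarrow> cofinal_in P leP (f ` B)"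
    unfolding tukey_le_def by blast
  have "\<exists>x\<in>Q. \<forall>q\<in>Q. leQ x q \<longrightarrow> leP p (f q)" if "p \<in> P" for p
  proof -
    have "\<not> cofinal_in P leP (f ` {q\<in>Q. \<not> leP p (f q)})"
      using that unfolding cofinal_in_def by blast
    then have "\<not> cofinal_in Q leQ {q\<in>Q. \<not> leP p (f q)}"
      using cof by blast
    then show ?thesis unfolding cofinal_in_def by blast
  qed
  then obtain \<psi> where "\<And>p. p \<in> P \<Longrightarrow> \<psi> p \<in> Q \<and> (\<forall>q\<in>Q. leQ (\<psi> p) q \<longrightarrow> leP p (f q))"
    by metis
  then show "\<exists>\<psi>\<in>P \<rightarrow> Q. \<forall>q\<in>Q. \<exists>b\<in>P. \<forall>p\<in>P. leQ (\<psi> p) q \<longrightarrow> leP p b"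
    using f by (intro bexI[of _ \<psi>]) blast+
next
  assume "\<exists>\<psi>\<in>P \<rightarrow> Q. \<forall>q\<in>Q. \<exists>b\<in>P. \<forall>p\<in>P. leQ (\<psi> p) q \<longrightarrow> leP p b"
  then obtain \<psi> where \<psi>: "\<psi> \<in> P \<rightarrow> Q"
    and bdd: "\<forall>q\<in>Q. \<exists>b\<in>P. \<forall>p\<in>P. leQ (\<psi> p) q \<longrightarrow> leP p b"
    by blast
  from bdd obtain f where f: "\<And>q. q \<in> Q \<Longrightarrow> f q \<in> P \<and> (\<forall>p\<in>P. leQ (\<psi> p) q \<longrightarrow> leP p (f q))"
    by metis
  have "cofinal_in P leP (f ` B)" if B: "cofinal_in Q leQ B" for B
    unfolding cofinal_in_def
  proof (intro conjI ballI)
    show "f ` B \<subseteq> P" using B f unfolding cofinal_in_def by blast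
  next
    fix p assume p: "p \<in> P"
    then obtain q where "q \<in> B" "leQ (\<psi> p) q" "q \<in> Q"
      using B \<psi> unfolding cofinal_in_def by blast
    then show "\<exists>y\<in>f ` B. leP p y" using f p by blast
  qed
  then show "tukey_le P leP Q leQ"
    unfolding tukey_le_def using f by (intro bexI[of _ f]) blast+
qed

lemma tukey_le_trans:
  assumes "tukey_le P leP Q leQ" "tukey_le Q leQ R leR"
  shows "tukey_le P leP R leR"
proof -
  obtain f g where "f \<in> Q \<rightarrow> P" "g \<in> R \<rightarrow> Q"
    and "\<And>B. cofinal_in Q leQ B \<Longrightarrow> cofinal_in P leP (f ` B)"
    and "\<And>B. cofinal_in R leR B \<Longrightarrow> cofinal_in Q leQ (g ` B)"
    using assms unfolding tukey_le_def by blast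
  then show ?thesis
    unfolding tukey_le_def
    by (intro bexI[of _ "f \<circ> g"] allI impI) (simp only: image_comp[symmetric], auto)
qed

lemma fun_tukey_leE:
  assumes "tukey_le (UNIV :: (nat \<Rightarrow> nat) set) (\<le>) U (\<supseteq>)"
  obtains \<psi> :: "(nat \<Rightarrow> nat) \<Rightarrow> 'a set" where "\<And>g. \<psi> g \<in> U"
    and "\<And>B. B \<in> U \<Longrightarrow> \<exists>h. \<forall>g. B \<subseteq> \<psi> g \<longrightarrow> g \<le> h"
proof -
  from assms obtain \<psi> :: "(nat \<Rightarrow> nat) \<Rightarrow> 'a set" where "\<forall>g. \<psi> g \<in> U"
    and "\<forall>B\<in>U. \<exists>h. \<forall>g. B \<subseteq> \<psi> g \<longrightarrow> g \<le> h"
    unfolding tukey_le_iff_unbounded_map by (auto simp: Pi_iff)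
  then show ?thesis by (intro that[of \<psi>]) simp_all
qed

section \<open>Compact families\<close>

lemma compact_UNIV_fun_bool: "compact (UNIV :: ('a \<Rightarrow> bool) set)"
proof -
  have "compact_space (euclidean :: bool topology)"
    by (simp add: compact_space_def finite_imp_compact)
  then have "compact_space (product_topology (\<lambda>_::'a. euclidean :: bool topology) UNIV)"
    by (simp add: compact_space_product_topology)
  then have "compact_space (euclidean :: ('a \<Rightarrow> bool) topology)"
    by (simp add: euclidean_product_topology)
  then show ?thesis by (metis compact_space_def compactin_euclidean_iff topspace_euclidean)
qed

text \<open>Only the trace on \<open>F\<close> matters: the set is a finite union, over the possible
  traces, of finite intersections of one-coordinate conditions.\<close>

lemma closed_cylinder:
  fixes F :: "'a set" and S :: "'a set set"
  assumes "finite F"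
  shows "closed {\<phi>. {x. \<phi> x} \<inter> F \<in> S}"
proof -
  have "{\<phi>. {x. \<phi> x} \<inter> F \<in> S} = (\<Union>s\<in>S \<inter> Pow F. \<Inter>x\<in>F. {\<phi>. \<phi> x = (x \<in> s)})"
    (is "?L = ?R")
  proof
    show "?L \<subseteq> ?R"
    proof
      fix \<phi> assume "\<phi> \<in> ?L"
      then show "\<phi> \<in> ?R" by (intro UN_I[of "{x. \<phi> x} \<inter> F"]) auto
    qed
    show "?R \<subseteq> ?L"
    proof
      fix \<phi> assume "\<phi> \<in> ?R"
      then obtain s where s: "s \<in> S" "s \<subseteq> F" "\<forall>x\<in>F. \<phi> x = (x \<in> s)" by blast
      then have "{x. \<phi> x} \<inter> F = s" by auto
      with s show "\<phi> \<in> ?L" by simp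
    qed
  qed
  moreover have "closed {\<phi> :: 'a \<Rightarrow> bool. \<phi> x = b}" for x b
    using closed_vimage[of "{b}" "\<lambda>\<phi> :: 'a \<Rightarrow> bool. \<phi> x"] by (simp add: vimage_def)
  ultimately show ?thesis
    using assms by (auto intro!: closed_UN closed_INT)
qed

text \<open>Each condition cuts out a cylinder, and any intersection of cylinders is closed in the
  compact Cantor space. The families built below from Tukey maps and from positive sets have this
  form.\<close>

lemma compact_family_of_finite_conditions:
  assumes "\<And>j. j \<in> J \<Longrightarrow> finite (F j)"
  shows "compact_family {Z. \<forall>j\<in>J. Z \<inter> F j \<in> S j}"
proof -
  have "(\<lambda>A n. n \<in> A) ` {Z. \<forall>j\<in>J. Z \<inter> F j \<in> S j} = (\<Inter>j\<in>J. {\<phi>. {x. \<phi> x} \<inter> F j \<in> S j})"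
    (is "?L = ?R")
  proof
    show "?R \<subseteq> ?L"
    proof
      fix \<phi> assume "\<phi> \<in> ?R"
      then show "\<phi> \<in> ?L" by (intro image_eqI[of _ _ "{x. \<phi> x}"]) auto
    qed
  qed auto
  moreover have "closed ?R" using assms by (intro closed_INT ballI closed_cylinder)
  ultimately show ?thesis
    unfolding compact_family_def
    using compact_Int_closed[OF compact_UNIV_fun_bool] by simp
qed

lemma compact_family_singleton: "compact_family {A}"
  unfolding compact_family_def by simp

text \<open>The open sets of those \<open>Z\<close> that contain a fixed \<open>b \<in> B\<close>
  cover the family; a finite subcover uses finitely many \<open>b\<close>, and \<open>h\<close> lies
  above them.\<close>

lemma compact_family_uniform_hit:
  assumes C: "compact_family \<C>" and hit: "\<And>Z. Z \<in> \<C> \<Longrightarrow> B \<inter> Z \<noteq> {}"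
  obtains h :: nat where "\<And>Z. Z \<in> \<C> \<Longrightarrow> B \<inter> Z \<inter> {..<h} \<noteq> {}"
proof -
  let ?K = "(\<lambda>A n. n \<in> A) ` \<C>"
  have op: "open {\<phi> :: nat \<Rightarrow> bool. \<phi> b}" for b
    using open_vimage[of "{True}" "\<lambda>\<phi> :: nat \<Rightarrow> bool. \<phi> b"] by (simp add: vimage_def open_discrete)
  have cov: "?K \<subseteq> (\<Union>b\<in>B. {\<phi>. \<phi> b})" using hit by force
  obtain D where D: "D \<subseteq> B" "finite D" "?K \<subseteq> (\<Union>b\<in>D. {\<phi>. \<phi> b})"
    using compactE_image[OF C[unfolded compact_family_def] op cov] by blast
  obtain h where h: "\<forall>x\<in>D. x < h"
    using D(2) finite_nat_set_iff_bounded by auto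
  show ?thesis
  proof (rule that[of h])
    fix Z assume "Z \<in> \<C>"
    then have "(\<lambda>n. n \<in> Z) \<in> (\<Union>b\<in>D. {\<phi>. \<phi> b})" using D(3) by blast
    then show "B \<inter> Z \<inter> {..<h} \<noteq> {}" using D(1) h by auto
  qed
qed

section \<open>Ultrafilters\<close>

lemma finite_diff_tail_subset:
  fixes Y X :: "nat set"
  assumes "finite (Y - X)"
  shows "\<exists>l>n. Y \<inter> {l..} \<subseteq> X"
proof -
  obtain l where l: "\<forall>x\<in>Y - X. x < l"
    using assms finite_nat_set_iff_bounded by auto
  have "Y \<inter> {max l (Suc n)..} \<subseteq> X"
  proof
    fix x assume "x \<in> Y \<inter> {max l (Suc n)..}"
    then have "x \<in> Y" "\<not> x < l" by auto
    then show "x \<in> X" using l by blast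
  qed
  then show ?thesis by (intro exI[of _ "max l (Suc n)"]) auto
qed

lemma strict_mono_interval:
  fixes k :: "nat \<Rightarrow> nat"
  assumes "strict_mono k" "k 0 \<le> n"
  obtains j where "k j \<le> n" "n < k (Suc j)"
proof -
  have "\<exists>j. n < k j" using strict_mono_imp_increasing[OF assms(1), of "Suc n"] Suc_le_eq by blast
  then have L: "n < k (LEAST j. n < k j)" by (rule LeastI_ex)
  show ?thesis
  proof (cases "LEAST j. n < k j")
    case 0
    then show ?thesis using L assms(2) by simp
  next
    case (Suc j)
    then have "\<not> n < k j" using not_less_Least[of j "\<lambda>j. n < k j"] by simp
    then show ?thesis using that[of j] L Suc by simp
  qed
qed

locale nonprincipal_ultrafilter =
  fixes U :: "nat set set"
  assumes uf: "ultrafilter U" and np: "nonprincipal U"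
begin

lemma UNIV_mem: "UNIV \<in> U" and empty_not_mem: "{} \<notin> U"
  using uf unfolding ultrafilter_def by auto

lemma mono_mem: "A \<in> U \<Longrightarrow> A \<subseteq> B \<Longrightarrow> B \<in> U"
  using uf unfolding ultrafilter_def by blast

lemma Int_mem: "A \<in> U \<Longrightarrow> B \<in> U \<Longrightarrow> A \<inter> B \<in> U"
  using uf unfolding ultrafilter_def by blast

lemma compl_mem_iff: "- A \<in> U \<longleftrightarrow> A \<notin> U"
proof -
  have "A \<inter> - A = {}" by simp
  then show ?thesis
    using uf Int_mem[of A "- A"] empty_not_mem unfolding ultrafilter_def by auto
qed

lemma meets: "A \<in> U \<Longrightarrow> B \<in> U \<Longrightarrow> A \<inter> B \<noteq> {}"
  using Int_mem empty_not_mem by fastforce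

lemma INT_mem: "finite I \<Longrightarrow> (\<And>i. i \<in> I \<Longrightarrow> X i \<in> U) \<Longrightarrow> (\<Inter>i\<in>I. X i) \<in> U"
  by (induction I rule: finite_induct) (auto simp: UNIV_mem Int_mem)

lemma singleton_not_mem: "{a} \<notin> U"
proof
  assume a: "{a} \<in> U"
  have "U = {A. a \<in> A}"
  proof (intro set_eqI iffI)
    fix A assume "A \<in> U"
    then show "A \<in> {A. a \<in> A}" using meets[OF a] by auto
  next
    fix A assume "A \<in> {A. a \<in> A}"
    then show "A \<in> U" using mono_mem[OF a, of A] by simp
  qed
  then show False using np unfolding nonprincipal_def by blast
qed

lemma cofinite_mem:
  assumes "finite A"
  shows "- A \<in> U"
proof -
  have "(\<Inter>a\<in>A. - {a}) \<in> U"
    using assms by (rule INT_mem) (simp add: compl_mem_iff singleton_not_mem)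
  then show ?thesis by (rule mono_mem) auto
qed

lemma atLeast_mem: "{n..} \<in> U"
  using cofinite_mem[of "{..<n}"] by simp

lemma greaterThan_mem: "{n<..} \<in> U"
  using cofinite_mem[of "{..n}"] by simp

lemma mem_obtain_ge:
  assumes "A \<in> U"
  obtains a where "a \<in> A" "n \<le> a"
  using meets[OF assms atLeast_mem[of n]] by auto

text \<open>A plain pseudo-intersection has a tail inside \<open>X n\<close> that may start long
  after \<open>n\<close>. Starting at \<open>n\<close> itself, for infinitely many \<open>n\<close>,
  lets \<open>Y\<close> later replace a set from \<open>n\<close> on while the trace below
  \<open>n\<close> is kept.\<close>

lemma p_point_pseudo_intersection_with_gaps:
  assumes "p_point U" and X: "\<And>n. X n \<in> U"
  obtains Y where "Y \<in> U" "\<And>N. \<exists>n\<ge>N. Y \<inter> {n..} \<subseteq> X n"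
proof -
  obtain Y where Y: "Y \<in> U" "\<And>n. finite (Y - X n)"
    using assms unfolding p_point_def by (metis image_subsetI)
  have "\<forall>n. \<exists>l>n. Y \<inter> {l..} \<subseteq> X n"
    using finite_diff_tail_subset[OF Y(2)] by blast
  then obtain l where l: "\<And>n. n < l n" "\<And>n. Y \<inter> {l n..} \<subseteq> X n"
    by metis
  define N where "N j = (l ^^ j) 0" for j
  have N_Suc: "N (Suc j) = l (N j)" for j by (simp add: N_def)
  have sm: "strict_mono N" by (simp add: strict_mono_Suc_iff N_Suc l(1))
  \<comment> \<open>On one of the two alternating unions of the blocks between consecutive \<open>N j\<close>, every other block
    is a gap, which absorbs the finite error \<open>{N j..<l (N j)}\<close>.\<close>
  define E where "E = (\<Union>j. {N (2*j)..<N (Suc (2*j))})"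
  show ?thesis
  proof (cases "E \<in> U")
    case True
    have gap: "E \<inter> {N (Suc (2*j))..<N (Suc (Suc (2*j)))} = {}" for j
    proof -
      have False if "N (2*i) \<le> x" "x < N (Suc (2*i))" "N (Suc (2*j)) \<le> x" "x < N (Suc (Suc (2*j)))" for i x
      proof -
        have "N (2*i) < N (Suc (Suc (2*j)))" "N (Suc (2*j)) < N (Suc (2*i))" using that by linarith+
        then have "2*i < Suc (Suc (2*j))" "Suc (2*j) < Suc (2*i)" using strict_mono_less[OF sm] by blast+
        then show False by presburger
      qed
      then show ?thesis unfolding E_def by fastforce
    qed
    show ?thesis
    proof (rule that[of "Y \<inter> E"])
      show "Y \<inter> E \<in> U" using Y True Int_mem by blast
      fix M
      have "Y \<inter> E \<inter> {N (Suc (2*M))..} \<subseteq> Y \<inter> {l (N (Suc (2*M)))..}"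
        using gap[of M] by (force simp: N_Suc not_less)
      then have "Y \<inter> E \<inter> {N (Suc (2*M))..} \<subseteq> X (N (Suc (2*M)))" using l(2) by blast
      moreover have "M \<le> N (Suc (2*M))" using strict_mono_imp_increasing[OF sm, of "Suc (2*M)"] by linarith
      ultimately show "\<exists>n\<ge>M. Y \<inter> E \<inter> {n..} \<subseteq> X n" by blast
    qed
  next
    case False
    show ?thesis
    proof (rule that[of "Y \<inter> - E"])
      show "Y \<inter> - E \<in> U" using Y False Int_mem compl_mem_iff by blast
      fix M
      have "- E \<inter> {N (2*M)..<N (Suc (2*M))} = {}" unfolding E_def by blast
      then have "Y \<inter> - E \<inter> {N (2*M)..} \<subseteq> Y \<inter> {l (N (2*M))..}"
        by (force simp: N_Suc not_less)
      then have "Y \<inter> - E \<inter> {N (2*M)..} \<subseteq> X (N (2*M))" using l(2) by blast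
      moreover have "M \<le> N (2*M)" using strict_mono_imp_increasing[OF sm, of "2*M"] by linarith
      ultimately show "\<exists>n\<ge>M. Y \<inter> - E \<inter> {n..} \<subseteq> X n" by blast
    qed
  qed
qed

section \<open>Tukey type of the Fubini square\<close>

text \<open>If \<open>D\<close> lies in \<open>A \<times> UNIV\<close>, then \<open>A\<close>
  contains every \<open>n\<close> whose section of \<open>D\<close> is in \<open>U\<close>, so the
  set of these \<open>n\<close> is the required bound.\<close>

lemma tukey_le_fubini: "tukey_le U (\<supseteq>) (fubini U U) (\<supseteq>)"
  unfolding tukey_le_iff_unbounded_map
proof (intro bexI[of _ "\<lambda>A. A \<times> UNIV"] ballI)
  show "(\<lambda>A. A \<times> UNIV) \<in> U \<rightarrow> fubini U U"
  proof
    fix A assume "A \<in> U"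
    then show "A \<times> UNIV \<in> fubini U U"
      using UNIV_mem unfolding fubini_def by (auto elim: mono_mem)
  qed
  fix D assume "D \<in> fubini U U"
  moreover have "{n. {m. (n, m) \<in> D} \<in> U} \<subseteq> A" if "D \<subseteq> A \<times> UNIV" for A
  proof
    fix n assume "n \<in> {n. {m. (n, m) \<in> D} \<in> U}"
    then have "{m. (n, m) \<in> D} \<noteq> {}" using empty_not_mem by force
    then show "n \<in> A" using that by auto
  qed
  ultimately show "\<exists>b\<in>U. \<forall>p\<in>U. D \<subseteq> p \<times> UNIV \<longrightarrow> b \<subseteq> p"
    unfolding fubini_def by blast
qed

text \<open>A member \<open>D\<close> of the product may miss column \<open>n\<close> but meets a
  later column \<open>N n\<close>. Partial sums of \<open>g\<close> are nondecreasing, so a point of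
  \<open>D\<close> there still bounds \<open>g n\<close>.\<close>

lemma fun_tukey_le_fubini:
  "tukey_le (UNIV :: (nat \<Rightarrow> nat) set) (\<le>) (fubini U U) (\<supseteq>)"
  unfolding tukey_le_iff_unbounded_map
proof (intro bexI[of _ "\<lambda>g. {(n, m). (\<Sum>i\<le>n. g i) < m}"] ballI)
  show "(\<lambda>g. {(n, m). (\<Sum>i\<le>n. g i) < m}) \<in> UNIV \<rightarrow> fubini U U"
    using greaterThan_mem UNIV_mem unfolding fubini_def greaterThan_def by auto
  fix D assume D: "D \<in> fubini U U"
  have "\<exists>n' m. n \<le> n' \<and> (n', m) \<in> D" for n
  proof -
    obtain n' where "n \<le> n'" "{m. (n', m) \<in> D} \<in> U"
      using D mem_obtain_ge[of "{n. {m. (n, m) \<in> D} \<in> U}" n] unfolding fubini_def by blast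
    moreover from this(2) obtain m where "(n', m) \<in> D" using mem_obtain_ge by blast
    ultimately show ?thesis by blast
  qed
  then obtain N h where h: "\<And>n. n \<le> N n" "\<And>n. (N n, h n) \<in> D" by metis
  have "g \<le> h" if "D \<subseteq> {(n, m). (\<Sum>i\<le>n. g i) < m}" for g
  proof (rule le_funI)
    fix n
    have "g n \<le> (\<Sum>i\<le>N n. g i)" using h(1) by (intro member_le_sum) auto
    also have "\<dots> < h n" using h(2) that by blast
    finally show "g n \<le> h n" by simp
  qed
  then show "\<exists>b\<in>UNIV. \<forall>p\<in>UNIV. D \<subseteq> {(n, m). (\<Sum>i\<le>n. p i) < m} \<longrightarrow> p \<le> b" by blast
qed

lemma fubini_tukey_le:
  assumes pp: "p_point U" and T: "tukey_le (UNIV :: (nat \<Rightarrow> nat) set) (\<le>) U (\<supseteq>)"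
  shows "tukey_le (fubini U U) (\<supseteq>) U (\<supseteq>)"
proof -
  obtain \<psi> :: "(nat \<Rightarrow> nat) \<Rightarrow> nat set" where \<psi>: "\<And>g. \<psi> g \<in> U"
    and bdd: "\<And>B. B \<in> U \<Longrightarrow> \<exists>h. \<forall>g. B \<subseteq> \<psi> g \<longrightarrow> g \<le> h"
    using T by (rule fun_tukey_leE) blast
  define \<pi> where "\<pi> D = {n. {m. (n, m) \<in> D} \<in> U}" for D :: "(nat \<times> nat) set"
  define tail where "tail D Y g \<longleftrightarrow> (\<forall>n\<in>\<pi> D. Y \<inter> {g n..} \<subseteq> {m. (n, m) \<in> D})"
    for D :: "(nat \<times> nat) set" and Y g
  have fub: "D \<in> fubini U U \<longleftrightarrow> \<pi> D \<in> U" for D by (simp add: fubini_def \<pi>_def)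
  have "\<exists>Y g. Y \<in> U \<and> tail D Y g" for D
  proof -
    \<comment> \<open>Small sections are replaced by \<open>UNIV\<close> so that the p-point
      property applies to the whole sequence.\<close>
    define X where "X n = (if n \<in> \<pi> D then {m. (n, m) \<in> D} else UNIV)" for n
    have "range X \<subseteq> U" by (auto simp: X_def \<pi>_def UNIV_mem)
    then obtain Y where Y: "Y \<in> U" "\<And>n. finite (Y - X n)"
      using pp[unfolded p_point_def, rule_format, of X] by metis
    have "\<forall>n. \<exists>l. Y \<inter> {l..} \<subseteq> X n"
      using finite_diff_tail_subset[OF Y(2)] by blast
    then obtain g where g: "\<And>n. Y \<inter> {g n..} \<subseteq> X n"
      by metis
    have "\<forall>n\<in>\<pi> D. Y \<inter> {g n..} \<subseteq> {m. (n, m) \<in> D}"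
    proof
      fix n assume "n \<in> \<pi> D"
      then show "Y \<inter> {g n..} \<subseteq> {m. (n, m) \<in> D}" using g[of n] by (simp add: X_def)
    qed
    then show ?thesis using Y(1) unfolding tail_def by blast
  qed
  then obtain Y g where Y: "\<And>D. Y D \<in> U" and g: "\<And>D. tail D (Y D) (g D)"
    by metis
  show ?thesis
    unfolding tukey_le_iff_unbounded_map
  proof (intro bexI[of _ "\<lambda>D. \<pi> D \<inter> Y D \<inter> \<psi> (g D)"] ballI)
    show "(\<lambda>D. \<pi> D \<inter> Y D \<inter> \<psi> (g D)) \<in> fubini U U \<rightarrow> U"
      using Y \<psi> Int_mem by (simp add: fub)
    fix B assume B: "B \<in> U"
    obtain h where h: "\<And>g. B \<subseteq> \<psi> g \<Longrightarrow> g \<le> h" using bdd[OF B] by blast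
    \<comment> \<open>Since \<open>h\<close> bounds every error function \<open>g D\<close> coded
      above \<open>B\<close>, the points of \<open>B \<times> B\<close> on or above its graph lie in
      each such \<open>D\<close>.\<close>
    define b where "b = {(n, m). n \<in> B \<and> m \<in> B \<inter> {h n..}}"
    have "B \<subseteq> \<pi> b"
    proof
      fix n assume "n \<in> B"
      then have "{m. (n, m) \<in> b} = B \<inter> {h n..}" by (auto simp: b_def)
      then show "n \<in> \<pi> b" using Int_mem[OF B atLeast_mem[of "h n"]] by (simp add: \<pi>_def)
    qed
    then have "b \<in> fubini U U" using mono_mem[OF B] by (simp add: fub)
    moreover have "b \<subseteq> D" if sub: "B \<subseteq> \<pi> D \<inter> Y D \<inter> \<psi> (g D)" for D
    proof clarify
      fix n m assume "(n, m) \<in> b"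
      then have nm: "n \<in> B" "m \<in> B" "h n \<le> m" by (auto simp: b_def)
      have "g D n \<le> h n" using h[of "g D"] sub by (simp add: le_fun_def)
      then have "m \<in> Y D \<inter> {g D n..}" using nm sub by auto
      then show "(n, m) \<in> D" using g[of D] nm(1) sub unfolding tail_def by blast
    qed
    ultimately show "\<exists>b\<in>fubini U U. \<forall>D\<in>fubini U U. B \<subseteq> \<pi> D \<inter> Y D \<inter> \<psi> (g D) \<longrightarrow> b \<subseteq> D"
      by blast
  qed
qed

section \<open>Strong p-points\<close>

lemma strong_p_pointE:
  assumes "strong_p_point U" "\<And>n. \<C> n \<subseteq> U" "\<And>n. compact_family (\<C> n)"
  obtains k :: "nat \<Rightarrow> nat" where "strict_mono k" "k 0 = 0"
    "\<forall>X. (\<forall>n. X n \<in> \<C> n) \<longrightarrow> (\<Union>n. X n \<inter> {k n..<k (Suc n)}) \<in> U"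
  using assms(1)[unfolded strong_p_point_def, rule_format, of \<C>] assms(2,3) by metis

text \<open>Singletons of the decreasing intersections \<open>X' n\<close> are compact; beyond
  \<open>k n\<close> the glued set consists of pieces of subsets of \<open>X n\<close>.\<close>

lemma strong_p_point_imp_p_point:
  assumes "strong_p_point U"
  shows "p_point U"
  unfolding p_point_def
proof (intro allI impI)
  fix X :: "nat \<Rightarrow> nat set" assume X: "range X \<subseteq> U"
  define X' where "X' n = (\<Inter>i\<in>{..n}. X i)" for n
  have "X' n \<in> U" for n
    unfolding X'_def using X by (intro INT_mem) auto
  then have "{X' n} \<subseteq> U" for n by simp
  then obtain k where k: "strict_mono k" "k 0 = 0"
    and mem: "\<forall>Z. (\<forall>n. Z n \<in> {X' n}) \<longrightarrow> (\<Union>n. Z n \<inter> {k n..<k (Suc n)}) \<in> U"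
    using compact_family_singleton by (rule strong_p_pointE[OF assms, of "\<lambda>n. {X' n}"])
  let ?Y = "\<Union>n. X' n \<inter> {k n..<k (Suc n)}"
  have "?Y - X n \<subseteq> {..<k n}" for n
  proof
    fix x assume x: "x \<in> ?Y - X n"
    then obtain j where j: "x \<in> X' j" "x < k (Suc j)" by auto
    then have "\<not> n \<le> j" using x unfolding X'_def by auto
    then have "k (Suc j) \<le> k n" using k(1) by (simp add: strict_mono_less_eq)
    then show "x \<in> {..<k n}" using j by simp
  qed
  then have "finite (?Y - X n)" for n by (meson finite_lessThan finite_subset)
  then show "\<exists>Y\<in>U. \<forall>n. finite (Y - X n)" using mem[rule_format, of X'] by blast
qed

text \<open>
  If \<open>\<psi>\<close> were an unbounded map, the p-point property would give a \<open>Y \<in> U\<close> below which the relation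
  \<open>reach B i m\<close> (some \<open>g\<close> with \<open>B \<subseteq> \<psi> g\<close> has \<open>m \<le> g i\<close>) depends only on a finite part of \<open>B\<close>
  determined by \<open>i\<close> and \<open>m\<close>. Hence, for fixed \<open>i\<close>, the sets \<open>Z\<close> for which \<open>Y - Z\<close> looks as if it reached
  every \<open>m\<close> form a compact subset of \<open>U\<close>, and a sufficiently fast \<open>g\<close> contradicts the partition
  obtained for these compact sets.
\<close>

lemma strong_p_point_imp_not_fun_tukey_le:
  assumes sp: "strong_p_point U"
  shows "\<not> tukey_le (UNIV :: (nat \<Rightarrow> nat) set) (\<le>) U (\<supseteq>)"
proof
  assume "tukey_le (UNIV :: (nat \<Rightarrow> nat) set) (\<le>) U (\<supseteq>)"
  then obtain \<psi> :: "(nat \<Rightarrow> nat) \<Rightarrow> nat set" where \<psi>: "\<And>g. \<psi> g \<in> U"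
    and bdd: "\<And>B. B \<in> U \<Longrightarrow> \<exists>h. \<forall>g. B \<subseteq> \<psi> g \<longrightarrow> g \<le> h"
    by (rule fun_tukey_leE) blast
  define reach where "reach B i m \<longleftrightarrow> (\<exists>g. B \<subseteq> \<psi> g \<and> m \<le> g i)" for B i m
  have anti: "reach B i m" if "reach B' i m" "B \<subseteq> B'" for B B' i m
    using that unfolding reach_def by blast
  have unreached: "\<exists>m. \<not> reach B i m" if B: "B \<in> U" for B i
  proof -
    obtain h where h: "\<And>g. B \<subseteq> \<psi> g \<Longrightarrow> g \<le> h" using bdd[OF B] by blast
    have "\<not> reach B i (Suc (h i))"
      unfolding reach_def using h by (metis le_funD not_less_eq_eq)
    then show ?thesis ..
  qed
  \<comment> \<open>Only finitely many triples \<open>(s, i, m)\<close> occur at stage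
    \<open>n\<close>, and \<open>reach\<close> passes to smaller sets, so the intersection of one
    witness per triple serves them all.\<close>
  have "\<exists>X\<in>U. \<forall>s\<in>Pow {..<n}. \<forall>i\<le>n. \<forall>m\<le>n.
          (\<exists>W\<in>U. reach (s \<union> W \<inter> {n..}) i m) \<longrightarrow> reach (s \<union> X \<inter> {n..}) i m" for n
  proof -
    let ?I = "Pow {..<n} \<times> {..n} \<times> {..n}"
    define Q where "Q t W \<longleftrightarrow> reach (fst t \<union> W \<inter> {n..}) (fst (snd t)) (snd (snd t))" for t W
    define W where "W t = (if \<exists>W\<in>U. Q t W then SOME W. W \<in> U \<and> Q t W else UNIV)" for t
    have W: "W t \<in> U \<and> ((\<exists>W\<in>U. Q t W) \<longrightarrow> Q t (W t))" for t
    proof (cases "\<exists>W\<in>U. Q t W")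
      case True
      then have "\<exists>W. W \<in> U \<and> Q t W" by blast
      from someI_ex[OF this] show ?thesis using True by (simp add: W_def)
    qed (simp add: W_def UNIV_mem)
    let ?X = "\<Inter>t\<in>?I. W t"
    have "?X \<in> U" using W by (intro INT_mem) auto
    moreover have "reach (s \<union> ?X \<inter> {n..}) i m"
      if "s \<in> Pow {..<n}" "i \<le> n" "m \<le> n" "\<exists>W\<in>U. reach (s \<union> W \<inter> {n..}) i m" for s i m
    proof -
      have "reach (s \<union> W (s, i, m) \<inter> {n..}) i m"
        using W[of "(s, i, m)"] that(4) by (simp add: Q_def)
      moreover have "?X \<subseteq> W (s, i, m)" using that(1-3) by (intro INT_lower) auto
      ultimately show ?thesis using anti by (meson Int_mono Un_mono subset_refl)
    qed
    ultimately show ?thesis by (intro bexI[of _ ?X]) blast+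
  qed
  then obtain X where X: "\<And>n. X n \<in> U"
    and dec: "\<And>n s i m. s \<in> Pow {..<n} \<Longrightarrow> i \<le> n \<Longrightarrow> m \<le> n \<Longrightarrow>
        \<exists>W\<in>U. reach (s \<union> W \<inter> {n..}) i m \<Longrightarrow> reach (s \<union> X n \<inter> {n..}) i m"
    by metis
  obtain Y where Y: "Y \<in> U" and gaps: "\<And>N. \<exists>n\<ge>N. Y \<inter> {n..} \<subseteq> X n"
    using p_point_pseudo_intersection_with_gaps[OF strong_p_point_imp_p_point[OF sp], of X] X by metis
  have "\<forall>i m. \<exists>n. i \<le> n \<and> m \<le> n \<and> Y \<inter> {n..} \<subseteq> X n"
    using gaps by (meson max.bounded_iff)
  then obtain n where n: "\<And>i m. i \<le> n i m" "\<And>i m. m \<le> n i m"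
    and nX: "\<And>i m. Y \<inter> {n i m..} \<subseteq> X (n i m)"
    by metis
  \<comment> \<open>For \<open>B \<subseteq> Y\<close> in \<open>U\<close>, this approximation
    reaches \<open>m\<close> at \<open>i\<close> exactly when \<open>B\<close> does: it contains
    \<open>B\<close>, and \<open>local\<close> gives the other direction.\<close>
  define appr where "appr i m B = B \<inter> {..<n i m} \<union> Y \<inter> {n i m..}" for i m B
  have local: "reach (appr i m B) i m" if "B \<in> U" "B \<subseteq> Y" "reach B i m" for B i m
  proof -
    have "(B \<inter> {..<n i m}) \<union> B \<inter> {n i m..} = B" by auto
    then have "\<exists>W\<in>U. reach ((B \<inter> {..<n i m}) \<union> W \<inter> {n i m..}) i m"
      using that by (intro bexI[of _ B]) simp_all
    then have "reach ((B \<inter> {..<n i m}) \<union> X (n i m) \<inter> {n i m..}) i m"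
      using n by (intro dec) auto
    then show ?thesis unfolding appr_def using nX[of i m] by (elim anti) auto
  qed
  define \<C> where "\<C> i = {Z. \<forall>m. reach (appr i m (Y - Z)) i m}" for i
  have "\<C> i \<subseteq> U" for i
  proof
    fix Z assume Z: "Z \<in> \<C> i"
    show "Z \<in> U"
    proof (rule ccontr)
      assume "Z \<notin> U"
      then have "Y - Z \<in> U" using Y by (simp add: Diff_eq Int_mem compl_mem_iff)
      then obtain m where "\<not> reach (Y - Z) i m" using unreached by blast
      moreover have "Y - Z \<subseteq> appr i m (Y - Z)" unfolding appr_def by auto
      ultimately show False using Z anti unfolding \<C>_def by blast
    qed
  qed
  moreover have "compact_family (\<C> i)" for i
  proof -
    have "\<C> i = {Z. \<forall>m\<in>UNIV. Z \<inter> {..<n i m} \<in> {s. reach (appr i m (Y - s)) i m}}"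
    proof -
      have "appr i m (Y - Z) = appr i m (Y - Z \<inter> {..<n i m})" for m Z
        unfolding appr_def by auto
      then show ?thesis unfolding \<C>_def by simp
    qed
    then show ?thesis by (simp only: compact_family_of_finite_conditions finite_lessThan)
  qed
  ultimately obtain k where k: "strict_mono k" "k 0 = 0"
    and kU: "\<forall>Z. (\<forall>i. Z i \<in> \<C> i) \<longrightarrow> (\<Union>i. Z i \<inter> {k i..<k (Suc i)}) \<in> U"
    by (rule strong_p_pointE[OF sp, of \<C>])
  have "\<forall>i t. \<exists>m. - t \<notin> \<C> i \<longrightarrow> \<not> reach (appr i m (Y \<inter> t)) i m"
    unfolding \<C>_def by (simp add: Diff_eq)
  then obtain M where M: "\<And>i t. - t \<notin> \<C> i \<Longrightarrow> \<not> reach (appr i (M i t) (Y \<inter> t)) i (M i t)"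
    by metis
  \<comment> \<open>\<open>B\<close> is defined from \<open>g\<close>, so \<open>g i\<close> has to
    dominate the failure stage \<open>M i t\<close> of every possible trace \<open>t\<close> of
    \<open>B\<close> below \<open>k (Suc i)\<close>.\<close>
  define g where "g i = (\<Sum>t\<in>Pow {..<k (Suc i)}. M i t)" for i
  define B where "B = \<psi> g \<inter> Y"
  have B: "B \<in> U" "B \<subseteq> Y" unfolding B_def using \<psi> Y Int_mem by auto
  \<comment> \<open>Otherwise the trace of \<open>B\<close> would fail to reach its stage, although
    \<open>g\<close> witnesses that \<open>B\<close> reaches it. Gluing these complements gives a
    set disjoint from \<open>B\<close>.\<close>
  have "- (B \<inter> {..<k (Suc i)}) \<in> \<C> i" for i
  proof (rule ccontr)
    let ?t = "B \<inter> {..<k (Suc i)}"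
    assume "- ?t \<notin> \<C> i"
    then have "\<not> reach (appr i (M i ?t) (Y \<inter> ?t)) i (M i ?t)" by (rule M)
    moreover have "M i ?t \<le> g i" unfolding g_def by (rule member_le_sum) auto
    then have "reach B i (M i ?t)" unfolding reach_def B_def by blast
    then have "reach (appr i (M i ?t) B) i (M i ?t)" using B local by blast
    then have "reach (appr i (M i ?t) (Y \<inter> ?t)) i (M i ?t)"
      by (rule anti) (auto simp: appr_def)
    ultimately show False by blast
  qed
  then have "(\<Union>i. - (B \<inter> {..<k (Suc i)}) \<inter> {k i..<k (Suc i)}) \<in> U" by (rule kU[rule_format])
  from meets[OF B(1) this] show False by auto
qed

section \<open>Positive sets of finite sets\<close>

text \<open>The generators are closed under finite intersections because \<open>U\<close> is, so
  positivity need only be tested on them.\<close>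

lemma positive_fin_filter_iff:
  "X \<in> positive_sets FIN (fin_filter U) \<longleftrightarrow> X \<subseteq> FIN \<and> (\<forall>A\<in>U. \<exists>a\<in>X. a \<subseteq> A)"
proof -
  have gen: "{a\<in>FIN. a \<subseteq> A} \<in> fin_filter U" if "A \<in> U" for A
    unfolding fin_filter_def generated_filter_def
    using that by (auto intro!: exI[of _ "{{a\<in>FIN. a \<subseteq> A}}"])
  have base: "\<exists>A\<in>U. {a\<in>FIN. a \<subseteq> A} \<subseteq> S" if S: "S \<in> fin_filter U" for S
  proof -
    obtain \<F> where \<F>: "finite \<F>" "\<F> \<subseteq> (\<lambda>A. {a\<in>FIN. a \<subseteq> A}) ` U" "FIN \<inter> \<Inter>\<F> \<subseteq> S"
      using S unfolding fin_filter_def generated_filter_def by blast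
    obtain \<A> where \<A>: "\<A> \<subseteq> U" "finite \<A>" "\<F> = (\<lambda>A. {a\<in>FIN. a \<subseteq> A}) ` \<A>"
      using \<F>(1,2) by (meson finite_subset_image)
    have "(\<Inter>A\<in>\<A>. A) \<in> U" using \<A> by (intro INT_mem) auto
    moreover have "{a\<in>FIN. a \<subseteq> (\<Inter>A\<in>\<A>. A)} \<subseteq> S" using \<F>(3) \<A>(3) by fast
    ultimately show ?thesis by blast
  qed
  show ?thesis
  proof
    assume X: "X \<in> positive_sets FIN (fin_filter U)"
    then have "X \<inter> {a\<in>FIN. a \<subseteq> A} \<noteq> {}" if "A \<in> U" for A
      using gen[OF that] unfolding positive_sets_def by blast
    then show "X \<subseteq> FIN \<and> (\<forall>A\<in>U. \<exists>a\<in>X. a \<subseteq> A)"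
      using X unfolding positive_sets_def by blast
  next
    assume X: "X \<subseteq> FIN \<and> (\<forall>A\<in>U. \<exists>a\<in>X. a \<subseteq> A)"
    have "X \<inter> S \<noteq> {}" if "S \<in> fin_filter U" for S
      using base[OF that] X by blast
    then show "X \<in> positive_sets FIN (fin_filter U)"
      using X unfolding positive_sets_def by blast
  qed
qed

text \<open>Witnesses \<open>A\<close> and \<open>B\<close> against the two parts combine to the
  witness \<open>A \<inter> B\<close> against the union.\<close>

lemma positive_Un:
  assumes "X \<union> Y \<in> positive_sets FIN (fin_filter U)"
  shows "X \<in> positive_sets FIN (fin_filter U) \<or> Y \<in> positive_sets FIN (fin_filter U)"
proof (rule ccontr)
  assume "\<not> ?thesis"
  then obtain A B where AB: "A \<in> U" "B \<in> U" "\<forall>a\<in>X. \<not> a \<subseteq> A" "\<forall>a\<in>Y. \<not> a \<subseteq> B"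
    using assms unfolding positive_fin_filter_iff by auto
  then have "A \<inter> B \<in> U" using Int_mem by simp
  then obtain a where "a \<in> X \<union> Y" "a \<subseteq> A \<inter> B"
    using assms unfolding positive_fin_filter_iff by meson
  then show False using AB by blast
qed

text \<open>Otherwise \<open>- Z\<close> is in \<open>U\<close> and includes an element of
  \<open>X\<close>.\<close>

lemma mem_if_meets_positive:
  assumes "X \<in> positive_sets FIN (fin_filter U)" "\<And>a. a \<in> X \<Longrightarrow> a \<inter> Z \<noteq> {}"
  shows "Z \<in> U"
proof (rule ccontr)
  assume "Z \<notin> U"
  then obtain a where "a \<in> X" "a \<subseteq> - Z"
    using assms(1) compl_mem_iff unfolding positive_fin_filter_iff by blast
  then show False using assms(2) by blast
qed

lemma strong_p_point_imp_P_plus: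
  assumes sp: "strong_p_point U"
  shows "P_plus_filter FIN (fin_filter U)"
  unfolding P_plus_filter_def
proof (intro allI impI)
  fix X :: "nat \<Rightarrow> nat set set"
  assume "range X \<subseteq> positive_sets FIN (fin_filter U)" and dec: "decseq X"
  then have X: "X n \<in> positive_sets FIN (fin_filter U)" for n by auto
  then have "X n \<subseteq> FIN" for n unfolding positive_fin_filter_iff by blast
  then have fin: "finite a" "a \<noteq> {}" if "a \<in> X n" for a n
    using that unfolding FIN_def by blast+
  \<comment> \<open>These are the transversals of \<open>X n\<close>; excluding the empty trace on
    each finite \<open>a\<close> is a condition on finitely many coordinates.\<close>
  define \<C> where "\<C> n = {Z. \<forall>a\<in>X n. Z \<inter> a \<in> - {{}}}" for n
  have "\<C> n \<subseteq> U" for n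
    using mem_if_meets_positive[OF X] unfolding \<C>_def by (auto simp: Int_commute)
  moreover have "compact_family (\<C> n)" for n
    unfolding \<C>_def using fin by (intro compact_family_of_finite_conditions)
  ultimately obtain k where k: "strict_mono k" "k 0 = 0"
    and kU: "\<forall>Z. (\<forall>n. Z n \<in> \<C> n) \<longrightarrow> (\<Union>n. Z n \<inter> {k n..<k (Suc n)}) \<in> U"
    by (rule strong_p_pointE[OF sp, of \<C>])
  define Y where "Y = (\<Union>n. {a\<in>X n. a \<subseteq> {k n..<k (Suc n)}})"
  have "\<exists>a\<in>Y. a \<subseteq> A" if A: "A \<in> U" for A
  proof (rule ccontr)
    assume no: "\<not> (\<exists>a\<in>Y. a \<subseteq> A)"
    \<comment> \<open>No \<open>a \<in> X n\<close> fits inside \<open>A\<close> within the block,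
      so each one meets this complement. The glued complements avoid \<open>A\<close>.\<close>
    have "- (A \<inter> {k n..<k (Suc n)}) \<in> \<C> n" for n
      using no unfolding \<C>_def Y_def by blast
    then have "(\<Union>n. - (A \<inter> {k n..<k (Suc n)}) \<inter> {k n..<k (Suc n)}) \<in> U" by (rule kU[rule_format])
    from meets[OF A this] show False by auto
  qed
  moreover have "Y \<subseteq> FIN" using fin unfolding Y_def FIN_def by blast
  moreover have "finite (Y - X n)" for n
  proof (rule finite_subset)
    show "Y - X n \<subseteq> Pow {..<k n}"
    proof
      fix a assume a: "a \<in> Y - X n"
      then obtain j where j: "a \<in> X j" "a \<subseteq> {k j..<k (Suc j)}" unfolding Y_def by blast
      then have "\<not> n \<le> j" using a dec unfolding decseq_def by blast
      then have "k (Suc j) \<le> k n" using k(1) by (simp add: strict_mono_less_eq)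
      then show "a \<in> Pow {..<k n}" using j by auto
    qed
  qed simp
  ultimately show "\<exists>Y\<in>positive_sets FIN (fin_filter U). \<forall>n. finite (Y - X n)"
    unfolding positive_fin_filter_iff[symmetric] by (meson positive_fin_filter_iff)
qed

lemma P_plus_imp_strong_p_point:
  assumes P: "P_plus_filter FIN (fin_filter U)"
  shows "strong_p_point U"
  unfolding strong_p_point_def
proof (intro allI impI)
  fix \<C> :: "nat \<Rightarrow> nat set set" assume "\<forall>n. \<C> n \<subseteq> U \<and> compact_family (\<C> n)"
  then have \<C>: "\<And>n Z. Z \<in> \<C> n \<Longrightarrow> Z \<in> U" "\<And>n. compact_family (\<C> n)" by blast+
  \<comment> \<open>Finite sets starting at \<open>n\<close> or later that meet all members of the
    first families. The lower bound makes every nonempty \<open>a\<close> drop out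
    eventually.\<close>
  define X where "X n = {a\<in>FIN. a \<subseteq> {n..} \<and> (\<forall>i\<le>n. \<forall>Z\<in>\<C> i. a \<inter> Z \<noteq> {})}" for n
  have "X n \<in> positive_sets FIN (fin_filter U)" for n
    unfolding positive_fin_filter_iff
  proof (intro conjI ballI)
    show "X n \<subseteq> FIN" unfolding X_def by blast
    fix A assume A: "A \<in> U"
    then have An: "A \<inter> {n..} \<in> U" using Int_mem atLeast_mem by blast
    have "\<exists>h. \<forall>Z\<in>\<C> i. A \<inter> {n..} \<inter> Z \<inter> {..<h} \<noteq> {}" for i
      using compact_family_uniform_hit[OF \<C>(2), of i "A \<inter> {n..}"] meets[OF An] \<C>(1) by metis
    then obtain h where h: "\<And>i Z. Z \<in> \<C> i \<Longrightarrow> A \<inter> {n..} \<inter> Z \<inter> {..<h i} \<noteq> {}" by metis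
    obtain a0 where a0: "a0 \<in> A \<inter> {n..}" using An mem_obtain_ge by metis
    \<comment> \<open>The summand \<open>Suc a0\<close> puts \<open>a0\<close> into
      \<open>a\<close>, so \<open>a\<close> is nonempty even if the families are empty.\<close>
    define H where "H = Suc a0 + (\<Sum>i\<le>n. h i)"
    have hH: "h i \<le> H" if "i \<le> n" for i
      using that member_le_sum[of i "{..n}" h] unfolding H_def by simp
    define a where "a = A \<inter> {n..} \<inter> {..<H}"
    have "a \<inter> Z \<noteq> {}" if "i \<le> n" "Z \<in> \<C> i" for i Z
      using h[OF that(2)] hH[OF that(1)] unfolding a_def by fastforce
    moreover have "a \<in> FIN" using a0 unfolding a_def FIN_def H_def by auto
    ultimately have "a \<in> X n" unfolding X_def a_def by blast
    then show "\<exists>a\<in>X n. a \<subseteq> A" by (rule bexI[rotated]) (simp add: a_def Int_assoc)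
  qed
  then have "range X \<subseteq> positive_sets FIN (fin_filter U)" by blast
  moreover have dec: "decseq X"
    unfolding decseq_def
  proof (intro allI impI)
    fix m n :: nat assume mn: "m \<le> n"
    show "X n \<subseteq> X m"
    proof
      fix a assume "a \<in> X n"
      then have "a \<in> FIN" "a \<subseteq> {n..}" "\<forall>i\<le>n. \<forall>Z\<in>\<C> i. a \<inter> Z \<noteq> {}" by (simp_all add: X_def)
      moreover from this(2) mn have "a \<subseteq> {m..}" by auto
      ultimately show "a \<in> X m" using mn order_trans[of _ m n] unfolding X_def by blast
    qed
  qed
  ultimately have "\<exists>Y\<in>positive_sets FIN (fin_filter U). \<forall>n. finite (Y - X n)"
    by (rule P[unfolded P_plus_filter_def, rule_format])
  then obtain Y where Y: "Y \<in> positive_sets FIN (fin_filter U)" "\<And>n. finite (Y - X n)"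
    by blast
  have "Y \<subseteq> FIN" using Y(1) unfolding positive_fin_filter_iff by blast
  then have YF: "finite a" "a \<noteq> {}" if "a \<in> Y" for a
    using that unfolding FIN_def by blast+
  have "\<exists>l>n. \<forall>a\<in>Y - X n. a \<subseteq> {..<l}" for n
  proof -
    have "finite (\<Union>(Y - X n))" using Y(2)[of n] YF by blast
    then obtain l where "\<forall>x\<in>\<Union>(Y - X n). x < l" using finite_nat_set_iff_bounded by auto
    then show ?thesis by (intro exI[of _ "max l (Suc n)"]) (auto simp: less_max_iff_disj)
  qed
  then obtain l where l: "\<And>n. n < l n" "\<And>n a. a \<in> Y - X n \<Longrightarrow> a \<subseteq> {..<l n}" by metis
  define k where "k j = (l ^^ j) 0" for j
  have k: "k 0 = 0" "\<And>j. k (Suc j) = l (k j)" by (simp_all add: k_def)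
  have sm: "strict_mono k" by (simp add: strict_mono_Suc_iff k l(1))
  have good: "(\<Union>n. Z n \<inter> {k' n..<k' (Suc n)}) \<in> U"
    if Z: "\<And>n. Z n \<in> \<C> n" and Y': "Y' \<in> positive_sets FIN (fin_filter U)"
      and ex: "\<And>a. a \<in> Y' \<Longrightarrow> \<exists>n. a \<in> X n \<and> a \<subseteq> {k' n..<k' (Suc n)}" for Z Y' k'
  proof (rule mem_if_meets_positive[OF Y'])
    fix a assume "a \<in> Y'"
    then obtain n where n: "a \<in> X n" "a \<subseteq> {k' n..<k' (Suc n)}" using ex by blast
    then have "a \<inter> Z n \<noteq> {}" using Z unfolding X_def by blast
    then show "a \<inter> (\<Union>n. Z n \<inter> {k' n..<k' (Suc n)}) \<noteq> {}" using n(2) by blast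
  qed
  \<comment> \<open>Each \<open>a \<in> Y\<close> lies in two consecutive blocks; one parity of the first block suffices for positivity.\<close>
  define blk where "blk j = {a\<in>X (k j). a \<subseteq> {k j..<k (Suc (Suc j))}}" for j
  have in_blk: "\<exists>j. a \<in> blk j" if a: "a \<in> Y" "a \<in> X 0" for a
  proof -
    have "\<exists>j. a \<notin> X (k j)"
    proof -
      obtain x where x: "x \<in> a" using YF[OF a(1)] by blast
      have "x < k (Suc x)" using strict_mono_imp_increasing[OF sm, of "Suc x"] by simp
      then have "a \<notin> X (k (Suc x))" using x unfolding X_def by auto
      then show ?thesis ..
    qed
    then have L: "a \<notin> X (k (LEAST j. a \<notin> X (k j)))" by (rule LeastI_ex)
    \<comment> \<open>\<open>Suc j\<close> is the first index at which \<open>a\<close> drops out.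
      The choice of \<open>l\<close> then keeps \<open>a\<close> below
      \<open>k (Suc (Suc j))\<close>, and membership in \<open>X (k j)\<close> gives the lower
      end.\<close>
    then obtain j where j: "(LEAST j. a \<notin> X (k j)) = Suc j"
      using a(2) k(1) by (cases "LEAST j. a \<notin> X (k j)") auto
    then have "a \<in> X (k j)" using not_less_Least[of j "\<lambda>j. a \<notin> X (k j)"] by simp
    moreover have "a \<subseteq> {..<k (Suc (Suc j))}" using L l(2)[of a "k (Suc j)"] a j k by simp
    ultimately have "a \<in> blk j" unfolding blk_def X_def by auto
    then show ?thesis ..
  qed
  have "(\<Union>j. blk j) \<in> positive_sets FIN (fin_filter U)"
    unfolding positive_fin_filter_iff
  proof (intro conjI ballI)
    show "(\<Union>j. blk j) \<subseteq> FIN" by (auto simp: blk_def X_def)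
    fix A assume A: "A \<in> U"
    \<comment> \<open>Elements of \<open>Y\<close> outside \<open>X 0\<close> lie below
      \<open>l 0\<close>, so a nonempty one from \<open>l 0\<close> on belongs to
      \<open>X 0\<close>.\<close>
    have "A \<inter> {l 0..} \<in> U" using A Int_mem atLeast_mem by blast
    then obtain a where a: "a \<in> Y" "a \<subseteq> A \<inter> {l 0..}"
      using Y(1) unfolding positive_fin_filter_iff by blast
    have "a \<in> X 0" using l(2)[of a 0] a YF[OF a(1)] by force
    then obtain j where "a \<in> blk j" using in_blk a(1) by blast
    then show "\<exists>a\<in>(\<Union>j. blk j). a \<subseteq> A" using a(2) by (intro bexI[of _ a]) auto
  qed
  moreover have "(\<Union>j. blk j) = (\<Union>j. blk (2*j)) \<union> (\<Union>j. blk (Suc (2*j)))"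
  proof -
    have "blk j \<subseteq> (\<Union>j. blk (2*j)) \<union> (\<Union>j. blk (Suc (2*j)))" for j
    proof (cases "even j")
      case True
      then obtain i where "j = 2*i" by (rule evenE)
      then show ?thesis by blast
    next
      case False
      then obtain i where "j = Suc (2*i)" by (elim oddE) simp
      then show ?thesis by blast
    qed
    then show ?thesis by blast
  qed
  ultimately consider "(\<Union>j. blk (2*j)) \<in> positive_sets FIN (fin_filter U)"
    | "(\<Union>j. blk (Suc (2*j))) \<in> positive_sets FIN (fin_filter U)"
    using positive_Un[of "\<Union>j. blk (2*j)" "\<Union>j. blk (Suc (2*j))"] by auto
  then show "\<exists>k. strict_mono k \<and> k 0 = 0 \<and>
      (\<forall>Z. (\<forall>n. Z n \<in> \<C> n) \<longrightarrow> (\<Union>n. Z n \<inter> {k n..<k (Suc n)}) \<in> U)"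
  proof cases
    case 1
    let ?k = "\<lambda>j. k (2*j)"
    have "\<exists>n. a \<in> X n \<and> a \<subseteq> {?k n..<?k (Suc n)}" if a: "a \<in> (\<Union>j. blk (2*j))" for a
    proof -
      obtain j where j: "a \<in> blk (2*j)" using a by blast
      have "j \<le> k (2*j)" using strict_mono_imp_increasing[OF sm, of "2*j"] by simp
      then have "X (k (2*j)) \<subseteq> X j" using dec unfolding decseq_def by blast
      then show ?thesis using j unfolding blk_def by (intro exI[of _ j]) auto
    qed
    then show ?thesis
      using good[OF _ 1, of _ ?k] k(1) sm
      by (intro exI[of _ ?k]) (auto simp: strict_mono_def)
  next
    case 2
    \<comment> \<open>The partition has to start at \<open>0\<close>, so the odd-indexed points are
      preceded by \<open>0\<close>; \<open>blk (Suc (2*j))\<close> then lies in block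
      \<open>Suc j\<close>.\<close>
    let ?k = "\<lambda>j. if j = 0 then 0 else k (2*j - 1)"
    have "\<exists>n. a \<in> X n \<and> a \<subseteq> {?k n..<?k (Suc n)}" if a: "a \<in> (\<Union>j. blk (Suc (2*j)))" for a
    proof -
      obtain j where j: "a \<in> blk (Suc (2*j))" using a by blast
      have "Suc j \<le> k (Suc (2*j))" using strict_mono_imp_increasing[OF sm, of "Suc (2*j)"] by simp
      then have "X (k (Suc (2*j))) \<subseteq> X (Suc j)" using dec unfolding decseq_def by blast
      then show ?thesis using j unfolding blk_def by (intro exI[of _ "Suc j"]) auto
    qed
    moreover have "strict_mono ?k"
    proof -
      have "0 < k (Suc j)" for j using strict_mono_less[OF sm, of 0 "Suc j"] k(1) by simp
      then show ?thesis using sm by (auto simp: strict_mono_Suc_iff strict_mono_less)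
    qed
    ultimately show ?thesis
      using good[OF _ 2, of _ ?k] by (intro exI[of _ ?k]) auto
  qed
qed

end

section \<open>Mathias forcing\<close>

lemma initial_segment_trans:
  "initial_segment c b \<Longrightarrow> initial_segment b a \<Longrightarrow> initial_segment c a"
  unfolding initial_segment_def by blast

lemma mathias_le_refl: "mathias_le p p"
  by (cases p) (simp add: initial_segment_def)

lemma mathias_le_trans:
  assumes "mathias_le p q" "mathias_le q r"
  shows "mathias_le p r"
proof -
  obtain a A b B c C where "p = (a, A)" "q = (b, B)" "r = (c, C)" by (metis surj_pair)
  then show ?thesis using assms by (auto intro: initial_segment_trans)
qed

lemma dense_belowD:
  "dense_below P le D p \<Longrightarrow> q \<in> P \<Longrightarrow> le q p \<Longrightarrow> \<exists>r\<in>P. le r q \<and> D r"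
  unfolding dense_below_def by blast

section \<open>Hitting times of compact families along a stem\<close>

definition hits :: "(nat \<Rightarrow> nat set set) \<Rightarrow> nat set \<Rightarrow> nat \<Rightarrow> nat \<Rightarrow> bool" where
  "hits \<C> a n h \<longleftrightarrow> (\<forall>i\<le>n. \<forall>Z\<in>\<C> i. a \<inter> Z \<inter> {n..<h} \<noteq> {})"

text \<open>A relation rather than a function, since a finite stem may not yet hit every
  member.\<close>

definition hit_time :: "(nat \<Rightarrow> nat set set) \<Rightarrow> nat set \<Rightarrow> nat \<Rightarrow> nat \<Rightarrow> bool" where
  "hit_time \<C> a n h \<longleftrightarrow> hits \<C> a n h \<and> (\<forall>h'<h. \<not> hits \<C> a n h')"

definition hit_time2 :: "(nat \<Rightarrow> nat set set) \<Rightarrow> nat set \<Rightarrow> nat \<Rightarrow> nat \<Rightarrow> bool" where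
  "hit_time2 \<C> a n m \<longleftrightarrow> (\<exists>h. hit_time \<C> a n h \<and> hit_time \<C> a h m)"

lemma hits_mono: "hits \<C> a n h \<Longrightarrow> a \<subseteq> b \<Longrightarrow> hits \<C> b n h"
  unfolding hits_def by blast

lemma hits_imp_hit_time: "hits \<C> a n h \<Longrightarrow> \<exists>h'. hit_time \<C> a n h'"
  unfolding hit_time_def by (rule exI[of _ "LEAST h. hits \<C> a n h"]) (auto intro: LeastI dest: not_less_Least)

lemma hit_time_unique: "hit_time \<C> a n h \<Longrightarrow> hit_time \<C> a n h' \<Longrightarrow> h = h'"
  unfolding hit_time_def by (metis linorder_neqE_nat)

lemma hit_time2_unique: "hit_time2 \<C> a n m \<Longrightarrow> hit_time2 \<C> a n m' \<Longrightarrow> m = m'"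
  unfolding hit_time2_def by (metis hit_time_unique)

text \<open>By minimality a positive \<open>h\<close> ends the window just after the element
  \<open>h - 1\<close> of \<open>a\<close>. An end-extension agrees with \<open>a\<close> up to
  there, so it cannot hit earlier.\<close>

lemma hit_time_initial_segment:
  assumes h: "hit_time \<C> a n h" and ab: "initial_segment a b"
  shows "hit_time \<C> b n h"
  unfolding hit_time_def
proof (intro conjI allI impI notI)
  show "hits \<C> b n h"
    using assms hits_mono unfolding hit_time_def initial_segment_def by blast
next
  fix h' assume h': "h' < h" "hits \<C> b n h'"
  then have "\<not> hits \<C> a n (h - 1)" using h by (simp add: hit_time_def)
  then obtain i Z where "i \<le> n" "Z \<in> \<C> i" "a \<inter> Z \<inter> {n..<h - 1} = {}"
    unfolding hits_def by blast
  moreover from this have "a \<inter> Z \<inter> {n..<h} \<noteq> {}"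
    using h unfolding hit_time_def hits_def by blast
  ultimately obtain x where x: "x \<in> a" "x \<in> {n..<h}" "x \<notin> {n..<h - 1}" by blast
  have "y \<in> a" if "y \<in> b" "y < h'" for y
  proof -
    have "y \<le> x" using x h'(1) that(2) by auto
    then show ?thesis using ab x(1) that(1) unfolding initial_segment_def by blast
  qed
  then have "b \<inter> {n..<h'} \<subseteq> a" by auto
  then have "hits \<C> a n h'" using h'(2) unfolding hits_def by blast
  then show False using h h'(1) unfolding hit_time_def by blast
qed

lemma hit_time2_initial_segment:
  "hit_time2 \<C> a n m \<Longrightarrow> initial_segment a b \<Longrightarrow> hit_time2 \<C> b n m"
  unfolding hit_time2_def by (blast intro: hit_time_initial_segment)

text \<open>
  The hitting time \<open>H\<close> of the generic real satisfies \<open>k (Suc j) < H n\<close> for \<open>k j \<le> n < k (Suc j)\<close>, which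
  says nothing about \<open>g n\<close> for \<open>n\<close> late in the block; \<open>H \<circ> H\<close> passes the next block as well.
\<close>

definition hit_name :: "(nat \<Rightarrow> nat set set) \<Rightarrow> (nat \<times> nat, nat set \<times> nat set) subset_name" where
  "hit_name \<C> = {((n, m), (a, A)) | n m a A. hit_time2 \<C> a n m}"

section \<open>Dominating reals and Mathias conditions\<close>

context nonprincipal_ultrafilter
begin

text \<open>By compactness the elements of \<open>A\<close> below some \<open>H\<close> already meet
  every member of the finitely many families from \<open>n\<close> on; these elements are moved into
  the stem.\<close>

lemma mathias_extend_hit_time:
  assumes \<C>: "\<forall>n. \<C> n \<subseteq> U \<and> compact_family (\<C> n)" and aA: "(a, A) \<in> mathias U"
  obtains b B h where "(b, B) \<in> mathias U" "mathias_le (b, B) (a, A)" "hit_time \<C> b n h"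
proof -
  from aA have A: "A \<in> U" "finite a" "\<forall>x\<in>a. \<forall>y\<in>A. x < y" unfolding mathias_def by auto
  have An: "A \<inter> {n..} \<in> U" using A(1) atLeast_mem Int_mem by blast
  have "\<exists>h. \<forall>Z\<in>\<C> i. A \<inter> {n..} \<inter> Z \<inter> {..<h} \<noteq> {}" for i
  proof -
    have "A \<inter> {n..} \<inter> Z \<noteq> {}" if "Z \<in> \<C> i" for Z using meets[OF An] \<C> that by blast
    then show ?thesis using compact_family_uniform_hit[of "\<C> i" "A \<inter> {n..}"] \<C> by metis
  qed
  then obtain h where h: "\<And>i Z. Z \<in> \<C> i \<Longrightarrow> A \<inter> {n..} \<inter> Z \<inter> {..<h i} \<noteq> {}" by metis
  define H where "H = (\<Sum>i\<le>n. h i)"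
  have hH: "h i \<le> H" if "i \<le> n" for i
    using that member_le_sum[of i "{..n}" h] unfolding H_def by simp
  let ?b = "a \<union> A \<inter> {..<H}"
  have "hits \<C> ?b n H"
    unfolding hits_def
  proof (intro allI impI ballI)
    fix i Z assume "i \<le> n" "Z \<in> \<C> i"
    then show "?b \<inter> Z \<inter> {n..<H} \<noteq> {}" using h[of Z i] hH[of i] by fastforce
  qed
  then obtain h' where "hit_time \<C> ?b n h'" using hits_imp_hit_time by blast
  moreover have "(?b, A \<inter> {H..}) \<in> mathias U"
    using A Int_mem[OF A(1) atLeast_mem[of H]] unfolding mathias_def by auto
  moreover have "initial_segment a ?b"
    unfolding initial_segment_def using A(3) leD by blast
  then have "mathias_le (?b, A \<inter> {H..}) (a, A)" by auto
  ultimately show ?thesis using that by blast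
qed

lemma forces_mem_hit_name_imp:
  assumes "forces_mem (mathias U) mathias_le (n, m) (hit_name \<C>) p" "p \<in> mathias U"
  obtains r where "r \<in> mathias U" "mathias_le r p" "hit_time2 \<C> (fst r) n m"
proof -
  obtain r s where r: "r \<in> mathias U" "mathias_le r p" "((n, m), s) \<in> hit_name \<C>" "mathias_le r s"
    using dense_belowD[OF assms(1)[unfolded forces_mem_def] assms(2) mathias_le_refl] by blast
  obtain a A where s: "s = (a, A)" "hit_time2 \<C> a n m" using r(3) unfolding hit_name_def by blast
  have "initial_segment a (fst r)" using r(4) s(1) by (cases r) simp
  then show ?thesis using that r s(2) hit_time2_initial_segment by blast
qed

lemma hit_time2_imp_forces_mem:
  assumes "hit_time2 \<C> a n m" "(a, A) \<in> mathias U"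
  shows "forces_mem (mathias U) mathias_le (n, m) (hit_name \<C>) (a, A)"
proof -
  have "((n, m), (a, A)) \<in> hit_name \<C>" using assms(1) unfolding hit_name_def by blast
  then show ?thesis
    unfolding forces_mem_def dense_below_def using assms(2) mathias_le_refl by blast
qed

text \<open>Two successive extensions decide the first and the second hitting time. Values forced by
  one condition agree because both are decided by a common longer stem.\<close>

lemma forces_function_hit_name:
  assumes \<C>: "\<forall>n. \<C> n \<subseteq> U \<and> compact_family (\<C> n)"
  shows "forces_function (mathias U) mathias_le (hit_name \<C>) p"
  unfolding forces_function_def forces_conj_def forces_all_def
proof (intro conjI allI)
  fix n
  show "forces_ex (mathias U) mathias_le
          (\<lambda>m. forces_mem (mathias U) mathias_le (n, m) (hit_name \<C>)) p"
    unfolding forces_ex_def dense_below_def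
  proof (intro ballI impI)
    fix q assume q: "q \<in> mathias U"
    obtain a A where qe: "q = (a, A)" by (cases q)
    obtain b B h where b: "(b, B) \<in> mathias U" "mathias_le (b, B) q" "hit_time \<C> b n h"
      using mathias_extend_hit_time[OF \<C> q[unfolded qe], of n] qe by metis
    obtain c C m where c: "(c, C) \<in> mathias U" "mathias_le (c, C) (b, B)" "hit_time \<C> c h m"
      using mathias_extend_hit_time[OF \<C> b(1), of h] by metis
    have "hit_time \<C> c n h" using b(3) c(2) hit_time_initial_segment by simp
    then have "hit_time2 \<C> c n m" using c(3) unfolding hit_time2_def by blast
    then have "forces_mem (mathias U) mathias_le (n, m) (hit_name \<C>) (c, C)"
      using c(1) by (rule hit_time2_imp_forces_mem)
    moreover have "mathias_le (c, C) q" using b(2) c(2) mathias_le_trans by blast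
    ultimately show "\<exists>r\<in>mathias U. mathias_le r q \<and>
        (\<exists>m. forces_mem (mathias U) mathias_le (n, m) (hit_name \<C>) r)"
      using c(1) by blast
  qed
next
  fix n m m'
  show "forces_imp (mathias U) mathias_le
          (\<lambda>p. forces_mem (mathias U) mathias_le (n, m) (hit_name \<C>) p \<and>
               forces_mem (mathias U) mathias_le (n, m') (hit_name \<C>) p)
          (forces_check (m = m')) p"
    unfolding forces_imp_def forces_check_def
  proof (intro ballI impI, elim conjE)
    fix q assume q: "q \<in> mathias U"
      and m: "forces_mem (mathias U) mathias_le (n, m) (hit_name \<C>) q"
      and m': "forces_mem (mathias U) mathias_le (n, m') (hit_name \<C>) q"
    obtain r where r: "r \<in> mathias U" "mathias_le r q" "hit_time2 \<C> (fst r) n m"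
      using forces_mem_hit_name_imp[OF m q] by blast
    have "forces_mem (mathias U) mathias_le (n, m') (hit_name \<C>) r"
      using m' r(2) mathias_le_trans unfolding forces_mem_def dense_below_def by blast
    then obtain r' where r': "mathias_le r' r" "hit_time2 \<C> (fst r') n m'"
      using forces_mem_hit_name_imp r(1) by blast
    have "initial_segment (fst r) (fst r')" using r'(1) by (cases r; cases r') simp
    then show "m = m'" using r(3) r'(2) hit_time2_initial_segment hit_time2_unique by blast
  qed
qed

text \<open>A partition growing faster than \<open>g\<close> fails for some selection
  \<open>X\<close>, so \<open>U\<close> contains a set \<open>Y\<close> missing \<open>X j\<close>
  on block \<open>j\<close>. Below \<open>Y\<close>, a window opened in block \<open>j\<close> must
  extend past that block.\<close>

lemma forces_dominates_hit_name:
  assumes bad: "\<forall>k. strict_mono k \<longrightarrow> k 0 = 0 \<longrightarrow>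
      (\<exists>X. (\<forall>n. X n \<in> \<C> n) \<and> (\<Union>n. X n \<inter> {k n..<k (Suc n)}) \<notin> U)"
  shows "forces_dominates (mathias U) mathias_le g (hit_name \<C>) p"
  unfolding forces_dominates_def forces_ex_def dense_below_def
proof (intro ballI impI)
  fix q assume q: "q \<in> mathias U"
  obtain a A where qe: "q = (a, A)" by (cases q)
  have A: "A \<in> U" "finite a" "\<forall>x\<in>a. \<forall>y\<in>A. x < y" using q qe unfolding mathias_def by auto
  define k where "k j = ((\<lambda>x. Suc (x + (\<Sum>l\<le>x. g l))) ^^ j) 0" for j
  have k0: "k 0 = 0" and kS: "k (Suc j) = Suc (k j + (\<Sum>l\<le>k j. g l))" for j
    by (simp_all add: k_def)
  have sm: "strict_mono k" by (simp add: strict_mono_Suc_iff kS)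
  have gk: "g l < k (Suc j)" if "l \<le> k j" for l j
    using that member_le_sum[of l "{..k j}" g] unfolding kS by simp
  obtain X where X: "\<And>n. X n \<in> \<C> n" "(\<Union>n. X n \<inter> {k n..<k (Suc n)}) \<notin> U"
    using bad sm k0 by blast
  define Y where "Y = - (\<Union>n. X n \<inter> {k n..<k (Suc n)})"
  have Y: "Y \<in> U" unfolding Y_def using X(2) compl_mem_iff by blast
  \<comment> \<open>From \<open>K\<close> on the old stem has no elements, so everything met there
    was taken from \<open>Y\<close>.\<close>
  obtain K where K: "\<forall>x\<in>a. x < K" using A(2) finite_nat_set_iff_bounded by auto
  define r where "r = (a, A \<inter> Y)"
  have r: "r \<in> mathias U" using A Y Int_mem unfolding r_def mathias_def by blast
  have rq: "mathias_le r q" unfolding r_def qe by (simp add: initial_segment_def)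
  have late: "k (Suc j) < h"
    if b: "mathias_le (b, B) r" and n: "K \<le> n" "k j \<le> n" "n < k (Suc j)"
      and hits: "hits \<C> b n h" for b B n h j
  proof -
    have "j \<le> n" using strict_mono_imp_increasing[OF sm, of j] n(2) by simp
    then have "b \<inter> X j \<inter> {n..<h} \<noteq> {}" using hits X(1)[of j] unfolding hits_def by blast
    then obtain x where x: "x \<in> b" "x \<in> X j" "n \<le> x" "x < h" by auto
    have "x \<notin> a" using K x(3) n(1) by auto
    then have "x \<in> Y" using x(1) b unfolding r_def by auto
    then have "\<not> (k j \<le> x \<and> x < k (Suc j))" using x(2) unfolding Y_def by auto
    then show ?thesis using x n(2) by simp
  qed
  have dom: "g n < m" if s: "mathias_le s r" "s \<in> mathias U" and n: "K \<le> n"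
      and mem: "forces_mem (mathias U) mathias_le (n, m) (hit_name \<C>) s" for s n m
  proof -
    obtain t where t: "mathias_le t s" "hit_time2 \<C> (fst t) n m"
      using forces_mem_hit_name_imp[OF mem s(2)] by blast
    obtain b B where te: "t = (b, B)" by (cases t)
    have br: "mathias_le (b, B) r" using mathias_le_trans[OF t(1) s(1)] te by simp
    obtain h where h: "hits \<C> b n h" "hits \<C> b h m"
      using t(2) te unfolding hit_time2_def hit_time_def by auto
    obtain j where j: "k j \<le> n" "n < k (Suc j)"
      using strict_mono_interval[OF sm, of n] k0 by auto
    have hj: "k (Suc j) < h" using late[OF br n j h(1)] .
    obtain i where i: "k i \<le> h" "h < k (Suc i)"
      using strict_mono_interval[OF sm, of h] k0 by auto
    have "k (Suc i) < m" using late[OF br _ i h(2)] n j(2) hj by linarith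
    moreover have "k (Suc j) < k (Suc i)" using hj i(2) by linarith
    then have "Suc j \<le> i" using strict_mono_less[OF sm] by simp
    then have "k (Suc j) \<le> k i" using strict_mono_less_eq[OF sm] by blast
    then have "n \<le> k i" using j(2) by linarith
    then have "g n < k (Suc i)" by (rule gk)
    ultimately show ?thesis by linarith
  qed
  have "forces_all (\<lambda>n. forces_imp (mathias U) mathias_le (forces_check (K \<le> n))
         (forces_all (\<lambda>m. forces_imp (mathias U) mathias_le
            (forces_mem (mathias U) mathias_le (n, m) (hit_name \<C>)) (forces_check (g n < m))))) r"
    unfolding forces_all_def forces_imp_def forces_check_def
  proof (intro allI ballI impI)
    fix n m s t
    assume "mathias_le t r" "K \<le> n" "s \<in> mathias U" "mathias_le s t"
      and "forces_mem (mathias U) mathias_le (n, m) (hit_name \<C>) s"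
    then show "g n < m" using dom mathias_le_trans by blast
  qed
  with r rq show "\<exists>r\<in>mathias U. mathias_le r q \<and>
      (\<exists>k. forces_all (\<lambda>n. forces_imp (mathias U) mathias_le (forces_check (k \<le> n))
         (forces_all (\<lambda>m. forces_imp (mathias U) mathias_le
            (forces_mem (mathias U) mathias_le (n, m) (hit_name \<C>)) (forces_check (g n < m))))) r)"
    by blast
qed

lemma canjar_imp_strong_p_point:
  assumes "canjar U"
  shows "strong_p_point U"
proof (rule ccontr)
  assume "\<not> strong_p_point U"
  then obtain \<C> where \<C>: "\<forall>n. \<C> n \<subseteq> U \<and> compact_family (\<C> n)"
    and no: "\<not> (\<exists>k. strict_mono k \<and> k 0 = 0 \<and>
        (\<forall>X. (\<forall>n. X n \<in> \<C> n) \<longrightarrow> (\<Union>n. X n \<inter> {k n..<k (Suc n)}) \<in> U))"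
    unfolding strong_p_point_def not_all not_imp by (elim exE conjE)
  have bad: "\<forall>k. strict_mono k \<longrightarrow> k 0 = 0 \<longrightarrow>
        (\<exists>X. (\<forall>n. X n \<in> \<C> n) \<and> (\<Union>n. X n \<inter> {k n..<k (Suc n)}) \<notin> U)"
    using no by meson
  have "adds_dominating_real (mathias U) mathias_le"
    unfolding adds_dominating_real_def forces_ex_def dense_below_def forces_conj_def forces_all_def
    using forces_function_hit_name[OF \<C>] forces_dominates_hit_name[OF bad] mathias_le_refl by blast
  then show False using assms unfolding canjar_def by blast
qed

text \<open>If \<open>B\<close> lies below the image of \<open>g\<close>, then shrinking the
  condition for \<open>g\<close> to \<open>(a g, B)\<close> keeps it dominating \<open>g\<close>,
  and its stem is one of finitely many sets determined by \<open>B\<close>.\<close>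

lemma adds_dominating_real_imp_fun_tukey_le:
  assumes "adds_dominating_real (mathias U) mathias_le"
  shows "tukey_le (UNIV :: (nat \<Rightarrow> nat) set) (\<le>) U (\<supseteq>)"
proof -
  let ?P = "mathias U"
  let ?le = mathias_le
  have "({}, UNIV) \<in> ?P" using UNIV_mem unfolding mathias_def by simp
  then obtain q \<tau> where q: "q \<in> ?P" and fn: "forces_function ?P ?le \<tau> q"
    and dom: "\<And>g. forces_dominates ?P ?le g \<tau> q"
    using assms mathias_le_refl
    unfolding adds_dominating_real_def forces_ex_def dense_below_def forces_conj_def forces_all_def
    by metis
  have "\<exists>a A k. (a, A) \<in> ?P \<and> ?le (a, A) q \<and>
      (\<forall>n\<ge>k. \<forall>m. \<forall>s\<in>?P. ?le s (a, A) \<longrightarrow> forces_mem ?P ?le (n, m) \<tau> s \<longrightarrow> g n < m)" for g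
  proof -
    obtain r k where r: "r \<in> ?P" "?le r q"
      and k: "forces_all (\<lambda>n. forces_imp ?P ?le (forces_check (k \<le> n))
         (forces_all (\<lambda>m. forces_imp ?P ?le
            (forces_mem ?P ?le (n, m) \<tau>) (forces_check (g n < m))))) r"
      using dense_belowD[OF dom[of g, unfolded forces_dominates_def forces_ex_def] q mathias_le_refl]
      by blast
    have "\<forall>n\<ge>k. \<forall>m. \<forall>s\<in>?P. ?le s r \<longrightarrow> forces_mem ?P ?le (n, m) \<tau> s \<longrightarrow> g n < m"
      using k r(1) mathias_le_refl unfolding forces_all_def forces_imp_def forces_check_def by blast
    then show ?thesis using r by (cases r) blast
  qed
  then obtain a A k where aA: "\<And>g. (a g, A g) \<in> ?P" "\<And>g. ?le (a g, A g) q"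
    and k: "\<And>g n m s. k g \<le> n \<Longrightarrow> s \<in> ?P \<Longrightarrow> ?le s (a g, A g) \<Longrightarrow>
       forces_mem ?P ?le (n, m) \<tau> s \<Longrightarrow> g n < m"
    by metis
  have fin: "finite (a g)" and AU: "A g \<in> U" and sep: "\<forall>x\<in>a g. \<forall>y\<in>A g. x < y" for g
    using aA(1)[of g] unfolding mathias_def by auto
  \<comment> \<open>Cutting the second coordinate at \<open>N g\<close> leaves finitely many stems, and bounds the values below \<open>k g\<close>,
    for all \<open>g\<close> sent above a given \<open>B\<close>; this upgrades eventual to everywhere domination.\<close>
  define N where "N g = k g + (\<Sum>i<k g. g i) + (\<Sum>x\<in>a g. x)" for g
  have N: "k g \<le> N g" "\<And>i. i < k g \<Longrightarrow> g i \<le> N g" "\<And>x. x \<in> a g \<Longrightarrow> x \<le> N g" for g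
  proof -
    show "k g \<le> N g" unfolding N_def by simp
    show "g i \<le> N g" if "i < k g" for i
      using that member_le_sum[of i "{..<k g}" g] unfolding N_def by simp
    show "x \<le> N g" if "x \<in> a g" for x
      using that member_le_sum[of x "a g" "\<lambda>x. x"] fin unfolding N_def by simp
  qed
  show ?thesis
    unfolding tukey_le_iff_unbounded_map
  proof (intro bexI[of _ "\<lambda>g. A g \<inter> {N g..}"] ballI)
    show "(\<lambda>g. A g \<inter> {N g..}) \<in> UNIV \<rightarrow> U" using AU atLeast_mem Int_mem by blast
    fix B assume B: "B \<in> U"
    obtain b0 where b0: "b0 \<in> B" using B mem_obtain_ge by blast
    \<comment> \<open>The values \<open>v c n\<close> depend only on \<open>B\<close> and a
      candidate stem \<open>c\<close>, not on \<open>g\<close>. Summing over all stems, plus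
      \<open>b0\<close> for arguments below \<open>k g\<close>, gives the common bound.\<close>
    define dec where "dec c n m \<longleftrightarrow> (\<exists>r\<in>?P. ?le r (c, B) \<and> forces_mem ?P ?le (n, m) \<tau> r)" for c n m
    define v where "v c n = (SOME m. dec c n m)" for c n
    define h where "h n = b0 + (\<Sum>c\<in>Pow {..b0}. v c n)" for n
    have "g \<le> h" if sub: "B \<subseteq> A g \<inter> {N g..}" for g
    proof (rule le_funI)
      fix n
      have Nb: "N g \<le> b0" using sub b0 by auto
      show "g n \<le> h n"
      proof (cases "n < k g")
        case True
        then show ?thesis using N(2)[of n g] Nb unfolding h_def by simp
      next
        case False
        have cP: "(a g, B) \<in> ?P" using fin sep B sub unfolding mathias_def by auto
        have cle: "?le (a g, B) (a g, A g)" using sub by (simp add: initial_segment_def)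
        then have "?le (a g, B) q" using aA(2) mathias_le_trans by blast
        moreover have "dense_below ?P ?le (\<lambda>q. \<exists>m. forces_mem ?P ?le (n, m) \<tau> q) q"
          using fn unfolding forces_function_def forces_conj_def forces_all_def forces_ex_def by blast
        ultimately have "\<exists>r\<in>?P. ?le r (a g, B) \<and> (\<exists>m. forces_mem ?P ?le (n, m) \<tau> r)"
          using cP by (intro dense_belowD)
        then have "\<exists>m. dec (a g) n m" unfolding dec_def by blast
        then have "dec (a g) n (v (a g) n)" unfolding v_def by (rule someI_ex)
        then obtain r where "r \<in> ?P" "?le r (a g, B)" "forces_mem ?P ?le (n, v (a g) n) \<tau> r"
          unfolding dec_def by blast
        then have "g n < v (a g) n" using k[of g n r] False cle mathias_le_trans by (meson not_le)
        moreover have "a g \<in> Pow {..b0}" using N(3)[of _ g] Nb by fastforce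
        then have "v (a g) n \<le> h n"
          using member_le_sum[of "a g" "Pow {..b0}" "\<lambda>c. v c n"] unfolding h_def by simp
        ultimately show ?thesis by simp
      qed
    qed
    then show "\<exists>b\<in>UNIV. \<forall>g\<in>UNIV. B \<subseteq> A g \<inter> {N g..} \<longrightarrow> g \<le> b" by blast
  qed
qed

end

theorem theorem2p5:
  fixes U :: "nat set set"
  assumes "ultrafilter U" and "nonprincipal U"
  shows
    "((tukey_less U (\<supseteq>) (fubini U U) (\<supseteq>) \<and> p_point U) \<longleftrightarrow>
        \<not> tukey_le (UNIV :: (nat \<Rightarrow> nat) set) (\<le>) U (\<supseteq>)) \<and>
     (\<not> tukey_le (UNIV :: (nat \<Rightarrow> nat) set) (\<le>) U (\<supseteq>) \<longleftrightarrow> canjar U) \<and>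
     (canjar U \<longleftrightarrow> strong_p_point U) \<and>
     (strong_p_point U \<longleftrightarrow> P_plus_filter FIN (fin_filter U))"
proof -
  interpret nonprincipal_ultrafilter U using assms by unfold_locales
  let ?T = "tukey_le (UNIV :: (nat \<Rightarrow> nat) set) (\<le>) U (\<supseteq>)"
  have sp: "\<not> ?T" if "strong_p_point U" using that by (rule strong_p_point_imp_not_fun_tukey_le)
  have can: "canjar U" if "\<not> ?T"
    using that adds_dominating_real_imp_fun_tukey_le unfolding canjar_def by blast
  have "tukey_less U (\<supseteq>) (fubini U U) (\<supseteq>) \<and> p_point U \<longleftrightarrow> \<not> ?T"
  proof
    assume "tukey_less U (\<supseteq>) (fubini U U) (\<supseteq>) \<and> p_point U"
    then show "\<not> ?T" using fubini_tukey_le unfolding tukey_less_def by blast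
  next
    assume T: "\<not> ?T"
    \<comment> \<open>A reduction of the square to \<open>U\<close> would compose with that of
      \<open>\<omega>^\<omega>\<close> to the square.\<close>
    then have "\<not> tukey_le (fubini U U) (\<supseteq>) U (\<supseteq>)"
      using tukey_le_trans[OF fun_tukey_le_fubini] by blast
    moreover have "p_point U"
      using T can canjar_imp_strong_p_point strong_p_point_imp_p_point by blast
    ultimately show "tukey_less U (\<supseteq>) (fubini U U) (\<supseteq>) \<and> p_point U"
      using tukey_le_fubini unfolding tukey_less_def by blast
  qed
  then show ?thesis
    using sp can canjar_imp_strong_p_point strong_p_point_imp_P_plus P_plus_imp_strong_p_point
    by blast
qed

end
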